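(* Let $r\in(0,1)$ and $A_r=\{z\in\mathbb{C}: r<|z|<1\}$. For any $z\in A_r$, $$H^c_{A_r}(z)=\sqrt r\left(1+\frac{\sqrt r}{|z|}\right)\left(1+\frac{|z|}{\sqrt r}\right)\left(\prod_{n=1}^{\infty}\frac{(1+|z|r^{2n-1/2})(|z|+r^{2n+1/2})}{(1+|z|r^{2n-3/2})(|z|+r^{2n-1/2})}\right)^2.$$
   Context: $\mathbb{D}$ is the open unit disk in $\mathbb{C}$, and $\rho_{\mathbb{D}}$ is the Poincaré distance on $\mathbb{D}$ with density $\frac{2}{1-|z|^2}$. For a Riemann surface $X$, the Carathéodory pseudo-distance is $c_X(z_1,z_2)=\sup\{\rho_{\mathbb{D}}(f(z_1),f(z_2)) : f:X\to\mathbb{D}\text{ holomorphic}\}$. Put $B^c_X(z;s)=\{w\in X: c_X(z,w)<s\}$. The Fridman function of $X$ with respect to the Carathéodory metric is $$H^c_X(z)=\sup\{\tanh\tfrac s2 : s>0,\ B^c_X(z;s)\subset f(\mathbb{D})\text{ for some injective holomorphic } f:\mathbb{D}\to X\}.$$ *)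

theory Defs
  imports "HOL-Complex_Analysis.Complex_Analysis"
begin

abbreviation unit_disk :: "complex set" where
  "unit_disk \<equiv> ball 0 1"

text \<open>The Riemannian distance of the metric \<open>2 \<bar>dz\<bar> / (1 - \<bar>z\<bar>\<^sup>2)\<close>.  Curves are
  continuously differentiable on the closed interval (not merely piecewise, in the sense of
  \<^const>\<open>valid_path\<close>): there the integrand is continuous, so the integral always exists,
  whereas \<^const>\<open>valid_path\<close> admits curves of infinite length, to which \<^const>\<open>integral\<close>
  would assign length 0.  The infimum is attained by the geodesics, which are smooth.\<close>

definition disk_length :: "(real \<Rightarrow> complex) \<Rightarrow> real" where
  "disk_length \<gamma> =
     integral {0..1} (\<lambda>t. 2 / (1 - (norm (\<gamma> t))\<^sup>2) * norm (vector_derivative \<gamma> (at t)))"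

definition poincare_dist :: "complex \<Rightarrow> complex \<Rightarrow> real" where
  "poincare_dist z w =
     Inf {disk_length \<gamma> | \<gamma>. \<gamma> C1_differentiable_on {0..1} \<and> path_image \<gamma> \<subseteq> unit_disk \<and>
                          pathstart \<gamma> = z \<and> pathfinish \<gamma> = w}"

text \<open>Below, the Riemann surface \<open>X\<close> is an open subset of the complex plane.  The supremum is
  taken in \<^typ>\<open>ereal\<close> and is finite when \<open>X\<close> is connected.\<close>

definition caratheodory_dist :: "complex set \<Rightarrow> complex \<Rightarrow> complex \<Rightarrow> ereal" where
  "caratheodory_dist X z w =
     Sup {ereal (poincare_dist (f z) (f w)) | f. f holomorphic_on X \<and> f ` X \<subseteq> unit_disk}"

definition caratheodory_ball :: "complex set \<Rightarrow> complex \<Rightarrow> real \<Rightarrow> complex set" where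
  "caratheodory_ball X z s = {w \<in> X. caratheodory_dist X z w < ereal s}"

text \<open>The set of values lies in the interval \<open>(0, 1)\<close>, and it is nonempty when \<open>X\<close> is a bounded
  domain and \<open>z \<in> X\<close>: small Caratheodory balls are then contained in Euclidean discs.\<close>

definition fridman_caratheodory :: "complex set \<Rightarrow> complex \<Rightarrow> real" where
  "fridman_caratheodory X z =
     Sup {tanh (s / 2) | s. s > 0 \<and>
            (\<exists>f. f holomorphic_on unit_disk \<and> inj_on f unit_disk \<and> f ` unit_disk \<subseteq> X \<and>
                 caratheodory_ball X z s \<subseteq> f ` unit_disk)}"

definition unit_annulus :: "real \<Rightarrow> complex set" where
  "unit_annulus r = {z. r < norm z \<and> norm z < 1}"

end

theory Submission
  imports Defs
begin

text \<open>Let \<open>q = r\<^sup>2\<close> and let \<open>\<theta>(x) = \<Prod>\<^sub>n (1 - q\<^sup>n x)(1 - q\<^sup>n\<^sup>+\<^sup>1/x)\<close>.  For \<open>\<bar>b\<bar> = \<surd>r\<close> the function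
  \<open>T b w = \<theta>(w/b) / \<theta>(w cnj b)\<close> vanishes only at \<open>b\<close> in the closed annulus and has constant modulus on
  each boundary circle, so \<open>F w = (r/w) (T b w) (T c w)\<close> with \<open>\<bar>b\<bar> = \<bar>c\<bar> = \<surd>r\<close> is unimodular on both
  circles.  Let \<open>c = -\<surd>r z/\<bar>z\<bar>\<close>, let \<open>K\<close> be such an \<open>F\<close> with \<open>b = c\<close> and let \<open>M = \<bar>K z\<bar>\<close>; this is
  the right-hand side of the claim.

  Lower bound: multiplied by a unimodular constant, \<open>K\<close> is a holomorphic map into the disk, positive
  at \<open>z\<close> and nonpositive on the opposite radius.  So the Caratheodory ball of radius
  \<open>2 artanh M\<close> avoids this radius, and the annulus slit along it is conformal to a disk.

  Upper bound: if \<open>g\<close> maps the annulus into the disk and \<open>g b = 0\<close> with \<open>\<bar>b\<bar> = \<surd>r\<close>, then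
  \<open>\<bar>g z\<bar> \<le> \<bar>F z\<bar>\<close>, because \<open>P w = \<theta>(w/c) \<theta>(w cnj c) / (\<theta>(w/z) \<theta>(w cnj z))\<close> is negative on the
  outer circle and positive on the inner one, has its only pole at \<open>z\<close>, and vanishes where \<open>g/F\<close> has
  its pole: comparing the circle means of \<open>(g/F) P\<close> with those of \<open>P\<close> gives the bound.  A reflection argument
  shows \<open>\<bar>T b z\<bar> \<le> \<bar>T c z\<bar>\<close>, hence \<open>\<bar>F z\<bar> \<le> M\<close>.  Larger balls therefore contain the circle of radius \<open>\<surd>r\<close>, which
  no simply connected subdomain of the annulus contains.\<close>

section \<open>Theta functions\<close>

text \<open>This is the infinite q-Pochhammer symbol, with the product starting at n = 0.\<close>

definition qpoch :: "real \<Rightarrow> complex \<Rightarrow> complex" where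
  "qpoch q x = (\<Prod>n. 1 - of_real (q ^ n) * x)"

text \<open>This is the Jacobi theta function in multiplicative form. At \<open>x = 0\<close> the
  convention for division by zero gives the value 1.\<close>

definition jtheta :: "real \<Rightarrow> complex \<Rightarrow> complex" where
  "jtheta q x = qpoch q x * qpoch q (of_real q / x)"

lemma qpoch_convergent:
  assumes "0 < q" "q < 1"
  shows "convergent_prod (\<lambda>n. 1 - of_real (q ^ n) * (x :: 'a :: {real_normed_field, banach}))"
proof -
  have "summable (\<lambda>n. q ^ n * norm x)"
    using assms by (intro summable_mult2 summable_geometric) auto
  then have "abs_convergent_prod (\<lambda>n. 1 - of_real (q ^ n) * x)"
    using assms by (intro summable_imp_abs_convergent_prod) (simp add: norm_mult norm_power)
  then show ?thesis
    by (rule abs_convergent_prod_imp_convergent_prod)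
qed

lemma qpoch_rec:
  assumes "0 < q" "q < 1"
  shows "qpoch q x = (1 - x) * qpoch q (of_real q * x)"
proof -
  have conv: "(\<lambda>n. \<Prod>i\<le>n. 1 - of_real (q ^ i) * y) \<longlonglongrightarrow> qpoch q y" for y :: complex
    unfolding qpoch_def by (intro convergent_prod_LIMSEQ qpoch_convergent assms)
  have "(\<lambda>n. \<Prod>i\<le>Suc n. 1 - of_real (q ^ i) * x) \<longlonglongrightarrow> qpoch q x"
    using conv[of x] by (subst filterlim_sequentially_Suc)
  moreover have "(\<Prod>i\<le>Suc n. 1 - of_real (q ^ i) * x) =
      (1 - x) * (\<Prod>i\<le>n. 1 - of_real (q ^ i) * (of_real q * x))" for n
    by (subst prod.atMost_Suc_shift) (simp add: mult_ac)
  ultimately have "(\<lambda>n. (1 - x) * (\<Prod>i\<le>n. 1 - of_real (q ^ i) * (of_real q * x))) \<longlonglongrightarrow> qpoch q x"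
    by simp
  moreover have "(\<lambda>n. (1 - x) * (\<Prod>i\<le>n. 1 - of_real (q ^ i) * (of_real q * x)))
      \<longlonglongrightarrow> (1 - x) * qpoch q (of_real q * x)"
    by (intro tendsto_intros conv)
  ultimately show ?thesis
    by (rule LIMSEQ_unique)
qed

lemma qpoch_nonzero:
  assumes "0 < q" "q < 1" "norm x < 1"
  shows "qpoch q x \<noteq> 0"
  unfolding qpoch_def
proof (intro prodinf_nonzero qpoch_convergent assms)
  fix n
  have "norm (of_real (q ^ n) * x) \<le> norm x"
    using assms by (simp add: norm_mult norm_power mult_left_le_one_le power_le_one)
  then have "norm (of_real (q ^ n) * x) < 1"
    using assms by linarith
  then show "1 - of_real (q ^ n) * x \<noteq> 0"
    by (metis eq_iff_diff_eq_0 less_irrefl norm_one)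
qed

lemma qpoch_holomorphic:
  assumes "0 < q" "q < 1"
  shows "qpoch q holomorphic_on A"
proof -
  have "qpoch q holomorphic_on UNIV"
  proof (rule holomorphic_uniform_sequence)
    show "(\<lambda>x. \<Prod>k<n. 1 - of_real (q ^ k) * x) holomorphic_on UNIV" for n
      by (intro holomorphic_intros)
    fix x :: complex
    \<comment> \<open>Local uniform convergence on unit balls is enough: there the n-th factor
      differs from 1 by at most \<open>q ^ n * (norm x + 1)\<close>.\<close>
    have "uniformly_convergent_on (cball x 1) (\<lambda>N y. \<Sum>n<N. norm ((1 - of_real (q ^ n) * y) - 1))"
    proof (rule Weierstrass_m_test'_ev[where M = "\<lambda>n. q ^ n * (norm x + 1)"])
      have "norm y \<le> norm x + 1" if "y \<in> cball x 1" for y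
        using that norm_triangle_ineq2[of y x] by (simp add: dist_norm norm_minus_commute)
      then show "\<forall>\<^sub>F n in sequentially. \<forall>y\<in>cball x 1.
          norm (norm ((1 - of_real (q ^ n) * y) - 1)) \<le> q ^ n * (norm x + 1)"
        using assms by (intro always_eventually) (auto simp: norm_mult norm_power)
      show "summable (\<lambda>n. q ^ n * (norm x + 1))"
        using assms by (intro summable_mult2 summable_geometric) auto
    qed
    then have "uniformly_convergent_on (cball x 1) (\<lambda>N y. \<Prod>n<N. 1 - of_real (q ^ n) * y)"
      by (intro uniformly_convergent_on_prod') (auto intro!: continuous_intros)
    then have "uniform_limit (cball x 1) (\<lambda>N y. \<Prod>n<N. 1 - of_real (q ^ n) * y)
        (\<lambda>y. lim (\<lambda>N. \<Prod>n<N. 1 - of_real (q ^ n) * y)) sequentially"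
      by (simp add: uniformly_convergent_uniform_limit_iff)
    moreover have "lim (\<lambda>N. \<Prod>n<N. 1 - of_real (q ^ n) * y) = qpoch q y" for y :: complex
      unfolding qpoch_def
      by (intro limI) (subst LIMSEQ_lessThan_iff_atMost,
          intro convergent_prod_LIMSEQ qpoch_convergent assms)
    ultimately show "\<exists>d>0. cball x d \<subseteq> UNIV \<and>
        uniform_limit (cball x d) (\<lambda>N y. \<Prod>n<N. 1 - of_real (q ^ n) * y) (qpoch q) sequentially"
      by (intro exI[of _ 1]) simp
  qed simp
  then show ?thesis
    by (rule holomorphic_on_subset) simp
qed

lemma qpoch_of_real:
  assumes "0 < q" "q < 1"
  shows "qpoch q (of_real x) = of_real (\<Prod>n. 1 - q ^ n * x)"
proof -
  have "(\<lambda>n. 1 - q ^ n * x) has_prod (\<Prod>n. 1 - q ^ n * x)"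
    using qpoch_convergent[OF assms, of x] by (intro convergent_prod_has_prod) simp
  then have "(\<lambda>n. complex_of_real (1 - q ^ n * x)) has_prod of_real (\<Prod>n. 1 - q ^ n * x)"
    by (subst has_prod_of_real_iff)
  then show ?thesis
    unfolding qpoch_def using has_prod_unique by fastforce
qed

lemma cnj_qpoch:
  assumes "0 < q" "q < 1"
  shows "cnj (qpoch q x) = qpoch q (cnj x)"
proof -
  have conv: "(\<lambda>n. \<Prod>i\<le>n. 1 - of_real (q ^ i) * y) \<longlonglongrightarrow> qpoch q y" for y :: complex
    unfolding qpoch_def by (intro convergent_prod_LIMSEQ qpoch_convergent assms)
  have "(\<lambda>n. cnj (\<Prod>i\<le>n. 1 - of_real (q ^ i) * x)) \<longlonglongrightarrow> cnj (qpoch q x)"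
    by (intro tendsto_intros conv)
  then show ?thesis
    using conv[of "cnj x"] by (simp add: LIMSEQ_unique)
qed

section \<open>Functional equations and zeros of theta\<close>

lemma cnj_jtheta:
  assumes "0 < q" "q < 1"
  shows "cnj (jtheta q x) = jtheta q (cnj x)"
  by (simp add: jtheta_def cnj_qpoch assms)

text \<open>Isolates the simple zero at \<open>x = 1\<close>. The remaining cofactor is invariant
  under inversion of \<open>x\<close> and has no zeros near the unit circle.\<close>

lemma jtheta_split:
  assumes "0 < q" "q < 1"
  shows "jtheta q x = (1 - x) * (qpoch q (of_real q * x) * qpoch q (of_real q / x))"
  using qpoch_rec[OF assms, of x] by (simp add: jtheta_def)

text \<open>Inversion swaps the two cofactors in \<open>jtheta_split\<close>, so only 1 - x changes,
  and 1 - 1/x = -(1 - x)/x.\<close>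

lemma jtheta_inverse:
  assumes "0 < q" "q < 1" "x \<noteq> 0"
  shows "jtheta q (1 / x) = - jtheta q x / x"
  using assms by (simp add: jtheta_split field_simps)

lemma jtheta_reflect:
  assumes "0 < q"
  shows "jtheta q (of_real q / x) = jtheta q x"
  using assms by (cases "x = 0") (simp_all add: jtheta_def mult.commute)

lemma jtheta_nonzero:
  assumes "0 < q" "q < 1" "q < norm x" "norm x < 1"
  shows "jtheta q x \<noteq> 0"
proof -
  have "x \<noteq> 0" using assms by auto
  then show ?thesis
    using assms qpoch_nonzero[of q x] qpoch_nonzero[of q "of_real q / x"]
    by (auto simp: jtheta_def norm_divide divide_less_eq)
qed

lemma jtheta_holomorphic:
  assumes "0 < q" "q < 1" "f holomorphic_on A" "\<And>w. w \<in> A \<Longrightarrow> f w \<noteq> 0"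
  shows "(\<lambda>w. jtheta q (f w)) holomorphic_on A"
proof -
  have *: "(\<lambda>w. qpoch q (g w)) holomorphic_on A" if "g holomorphic_on A" for g
    using holomorphic_on_compose[OF that qpoch_holomorphic] assms by (simp add: o_def)
  then show ?thesis
    unfolding jtheta_def using assms by (intro holomorphic_on_mult * holomorphic_on_divide) auto
qed

section \<open>Circle means and a dual extremal problem\<close>

text \<open>The parameter interval has length 1, so this is the normalised mean. The value type is
  general because both complex functions and their real norms are averaged.\<close>

definition circle_mean :: "(complex \<Rightarrow> 'a::euclidean_space) \<Rightarrow> real \<Rightarrow> 'a" where
  "circle_mean f \<rho> = integral {0..1} (\<lambda>t. f (circlepath 0 \<rho> t))"

text \<open>Up to the factor 2 pi i, the mean is the contour integral of \<open>f w / w\<close>, and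
  the two circles are linearly homotopic inside the annulus.\<close>

lemma circle_mean_const:
  fixes f :: "complex \<Rightarrow> complex"
  assumes f: "f holomorphic_on {w. \<alpha> < norm w \<and> norm w < \<beta>}"
    and "0 \<le> \<alpha>" "\<alpha> < \<rho>1" "\<rho>1 \<le> \<rho>2" "\<rho>2 < \<beta>"
  shows "circle_mean f \<rho>1 = circle_mean f \<rho>2"
proof -
  define B where "B = {w::complex. \<alpha> < norm w \<and> norm w < \<beta>}"
  have "B = ball 0 \<beta> - cball 0 \<alpha>" by (auto simp: B_def)
  then have "open B" by (simp add: open_Diff)
  have eq: "contour_integral (circlepath 0 \<rho>) (\<lambda>w. f w / w) = 2 * pi * \<i> * circle_mean f \<rho>"
    if "\<rho> > 0" for \<rho>
  proof -
    have *: "circlepath 0 \<rho> t \<noteq> 0" for t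
      using that by (simp add: circlepath)
    have "contour_integral (circlepath 0 \<rho>) (\<lambda>w. f w / w) =
        integral {0..1} (\<lambda>t. f (circlepath 0 \<rho> t) / circlepath 0 \<rho> t *
          vector_derivative (circlepath 0 \<rho>) (at t))"
      by (simp add: contour_integral_integral)
    also have "\<dots> = integral {0..1} (\<lambda>t. 2 * pi * \<i> * f (circlepath 0 \<rho> t))"
    proof (intro integral_cong)
      fix t :: real
      have "vector_derivative (circlepath 0 \<rho>) (at t) = 2 * pi * \<i> * circlepath 0 \<rho> t"
        by (simp add: vector_derivative_circlepath) (simp add: circlepath)
      then show "f (circlepath 0 \<rho> t) / circlepath 0 \<rho> t * vector_derivative (circlepath 0 \<rho>) (at t) =
          2 * pi * \<i> * f (circlepath 0 \<rho> t)"
        using *[of t] by (simp only:) simp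
    qed
    finally show ?thesis by (simp add: circle_mean_def)
  qed
  have "homotopic_loops B (circlepath 0 \<rho>1) (circlepath 0 \<rho>2)"
  proof (rule homotopic_loops_linear)
    fix t :: real assume "t \<in> {0..1}"
    show "closed_segment (circlepath 0 \<rho>1 t) (circlepath 0 \<rho>2 t) \<subseteq> B"
    proof
      fix x assume "x \<in> closed_segment (circlepath 0 \<rho>1 t) (circlepath 0 \<rho>2 t)"
      then obtain u where u: "0 \<le> u" "u \<le> 1"
        and x: "x = (1 - u) *\<^sub>R circlepath 0 \<rho>1 t + u *\<^sub>R circlepath 0 \<rho>2 t"
        by (auto simp: in_segment)
      have "x = of_real ((1 - u) * \<rho>1 + u * \<rho>2) * exp (2 * pi * \<i> * t)"
        unfolding x circlepath by (simp add: scaleR_conv_of_real algebra_simps)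
      then have nx: "norm x = \<bar>(1 - u) * \<rho>1 + u * \<rho>2\<bar>"
        by (simp only: norm_mult norm_of_real norm_exp_eq_Re) simp
      have "(1 - u) * \<rho>1 + u * \<rho>2 = \<rho>1 + u * (\<rho>2 - \<rho>1)" by (simp add: algebra_simps)
      moreover have "0 \<le> u * (\<rho>2 - \<rho>1)" "u * (\<rho>2 - \<rho>1) \<le> \<rho>2 - \<rho>1"
        using u assms by (auto intro: mult_left_le_one_le)
      ultimately show "x \<in> B"
        using assms nx by (simp add: B_def)
    qed
  qed simp_all
  moreover have "(\<lambda>w. f w / w) holomorphic_on B"
    using f assms by (intro holomorphic_intros) (auto simp: B_def)
  ultimately have "contour_integral (circlepath 0 \<rho>1) (\<lambda>w. f w / w) =
      contour_integral (circlepath 0 \<rho>2) (\<lambda>w. f w / w)"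
    using \<open>open B\<close> by (intro Cauchy_theorem_homotopic_loops) auto
  then show ?thesis using assms by (simp add: eq)
qed

lemma circlepath_integrable:
  fixes f :: "complex \<Rightarrow> 'a::euclidean_space"
  assumes "continuous_on (sphere 0 \<rho>) f" "0 \<le> \<rho>"
  shows "(\<lambda>t. f (circlepath 0 \<rho> t)) integrable_on {0..1}"
proof (intro integrable_continuous_real continuous_on_compose2[OF assms(1)])
  show "continuous_on {0..1} (circlepath 0 \<rho>)"
    using path_circlepath[of 0 \<rho>] by (simp add: path_def)
  show "circlepath 0 \<rho> ` {0..1} \<subseteq> sphere 0 \<rho>"
    using assms by (auto simp: circlepath norm_mult)
qed

text \<open>Used to pass from circles inside the annulus to the boundary circles.\<close>

lemma circle_mean_continuous:
  fixes f :: "complex \<Rightarrow> 'a::euclidean_space"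
  assumes f: "continuous_on {w. \<alpha> \<le> norm w \<and> norm w \<le> \<beta>} f" and "0 \<le> \<alpha>"
  shows "continuous_on {\<alpha>..\<beta>} (circle_mean f)"
proof -
  have "continuous_on ({\<alpha>..\<beta>} \<times> cbox 0 1) (\<lambda>(\<rho>, t). f (circlepath 0 \<rho> t))"
    unfolding case_prod_beta
  proof (rule continuous_on_compose2[OF f])
    show "continuous_on ({\<alpha>..\<beta>} \<times> cbox 0 1) (\<lambda>p. circlepath 0 (fst p) (snd p))"
      unfolding circlepath by (intro continuous_intros)
    show "(\<lambda>p. circlepath 0 (fst p) (snd p)) ` ({\<alpha>..\<beta>} \<times> cbox 0 1) \<subseteq> {w. \<alpha> \<le> norm w \<and> norm w \<le> \<beta>}"
      using assms by (auto simp: circlepath norm_mult)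
  qed
  then have "continuous_on {\<alpha>..\<beta>} (\<lambda>\<rho>. integral (cbox 0 1) (\<lambda>t. f (circlepath 0 \<rho> t)))"
    by (rule integral_continuous_on_param)
  then show ?thesis by (simp add: circle_mean_def [abs_def] cbox_interval)
qed

lemma circle_mean_diff_cmul:
  fixes f :: "complex \<Rightarrow> complex"
  assumes "continuous_on (sphere 0 \<rho>) f" "continuous_on (sphere 0 \<rho>) h" "0 \<le> \<rho>"
  shows "circle_mean (\<lambda>w. f w - c * h w) \<rho> = circle_mean f \<rho> - c * circle_mean h \<rho>"
  using assms circlepath_integrable[of \<rho> f] circlepath_integrable[of \<rho> "\<lambda>w. c * h w"]
  by (simp add: circle_mean_def integral_diff continuous_on_mult)

lemma circle_mean_cong:
  assumes "\<And>w. norm w = \<rho> \<Longrightarrow> f w = h w" "0 \<le> \<rho>"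
  shows "circle_mean f \<rho> = circle_mean h \<rho>"
  unfolding circle_mean_def
  using assms by (intro integral_cong) (simp add: circlepath norm_mult)

lemma norm_circle_mean_le:
  assumes "continuous_on (sphere 0 \<rho>) f" "continuous_on (sphere 0 \<rho>) h" "0 \<le> \<rho>"
    and "\<And>w. norm w = \<rho> \<Longrightarrow> norm (f w) \<le> h w"
  shows "norm (circle_mean f \<rho>) \<le> circle_mean h \<rho>"
  unfolding circle_mean_def
  using assms by (intro integral_norm_bound_integral circlepath_integrable)
    (simp_all add: circlepath norm_mult)

lemma circle_mean_of_real:
  assumes "continuous_on (sphere 0 \<rho>) h" "0 \<le> \<rho>"
  shows "circle_mean (\<lambda>w. complex_of_real (h w)) \<rho> = of_real (circle_mean h \<rho>)"
proof -
  have "(\<lambda>t. h (circlepath 0 \<rho> t)) integrable_on {0..1}"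
    by (intro circlepath_integrable assms)
  from has_integral_of_real[OF integrable_integral[OF this], where 'b = complex] show ?thesis
    by (simp add: circle_mean_def integral_unique)
qed

lemma circle_mean_pos:
  assumes "continuous_on (sphere 0 \<rho>) h" "0 \<le> \<rho>" "\<And>w. norm w = \<rho> \<Longrightarrow> h w > (0::real)"
  shows "circle_mean h \<rho> > 0"
proof -
  have pos: "h (circlepath 0 \<rho> t) > 0" for t
    using assms by (simp add: circlepath norm_mult)
  have cont: "continuous_on {0..1} (\<lambda>t. h (circlepath 0 \<rho> t))"
  proof (intro continuous_on_compose2[OF assms(1)])
    show "continuous_on {0..1} (circlepath 0 \<rho>)"
      using path_circlepath[of 0 \<rho>] by (simp add: path_def)
    show "circlepath 0 \<rho> ` {0..1} \<subseteq> sphere 0 \<rho>"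
      using assms by (auto simp: circlepath norm_mult)
  qed
  have "circle_mean h \<rho> \<ge> 0"
    unfolding circle_mean_def using pos by (intro integral_nonneg circlepath_integrable assms) (simp add: less_imp_le)
  moreover have "circle_mean h \<rho> \<noteq> 0"
    unfolding circle_mean_def using integral_eq_0_iff[OF cont] pos
    by (metis atLeastAtMost_iff cont integral_eq_0_iff less_irrefl order_less_imp_le zero_le_one order_refl zero_less_one)
  ultimately show ?thesis by simp
qed

text \<open>The zeros are divided out one after the other by difference quotients with removable
  singularities; since a and b differ, the first quotient still vanishes at
  \<open>b\<close>.\<close>

lemma holomorphic_factor_two_zeros:
  assumes G: "G holomorphic_on S" "open S" and ab: "a \<in> S" "b \<in> S" "a \<noteq> b" "G a = 0" "G b = 0"
  obtains H where "H holomorphic_on S" "\<And>w. w \<in> S \<Longrightarrow> G w = (w - a) * (w - b) * H w"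
proof -
  define H1 where "H1 = (\<lambda>z. if z = a then deriv G a else (G z - G a) / (z - a))"
  have H1: "H1 holomorphic_on S"
    unfolding H1_def by (rule pole_lemma_open[OF G])
  define H where "H = (\<lambda>z. if z = b then deriv H1 b else (H1 z - H1 b) / (z - b))"
  have "H holomorphic_on S"
    unfolding H_def by (rule pole_lemma_open[OF H1 G(2)])
  moreover have "G w = (w - a) * (w - b) * H w" if "w \<in> S" for w
    using ab that by (auto simp: H1_def H_def)
  ultimately show ?thesis using that by blast
qed


text \<open>With \<open>l = g a / F a\<close>, the function (g - l F) R / ((w - a)(w - b)) has only
  removable singularities, so its means over all circles agree. On the boundary the P-terms have
  opposite signs and add up, while the g-terms are bounded by the means of |P|; hence |l| is at most
  1.\<close>

lemma dual_extremal:
  fixes F R g :: "complex \<Rightarrow> complex" and r :: real and a b :: complex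
  defines "A \<equiv> {w. r < norm w \<and> norm w < 1}" and "C \<equiv> {w. r \<le> norm w \<and> norm w \<le> 1}"
  defines "P \<equiv> \<lambda>w. F w * R w / ((w - a) * (w - b))"
  assumes "0 < r" and ab: "a \<in> A" "b \<in> A" "a \<noteq> b"
    and F: "continuous_on C F" "F holomorphic_on A" "F b = 0" "F a \<noteq> 0"
    and R: "continuous_on C R" "R holomorphic_on A"
    and g: "g holomorphic_on A" "\<And>w. w \<in> A \<Longrightarrow> norm (g w) \<le> 1" "g b = 0"
    and outer: "\<And>w. norm w = 1 \<Longrightarrow> norm (F w) = 1 \<and> (\<exists>p>0. P w = - of_real p)"
    and inner: "\<And>w. norm w = r \<Longrightarrow> norm (F w) = 1 \<and> (\<exists>p>0. P w = of_real p)"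
  shows "norm (g a) \<le> norm (F a)"
proof -
  have "A = ball 0 1 - cball 0 r" by (auto simp: A_def)
  then have "open A" by (simp add: open_Diff)
  \<comment> \<open>This multiple makes \<open>g - l * F\<close> vanish at \<open>a\<close>; at
    \<open>b\<close> both functions vanish already.\<close>
  define l where "l = g a / F a"
  define Q where "Q = (\<lambda>w. R w / ((w - a) * (w - b)))"
  have PQ: "P w = F w * Q w" for w by (simp add: P_def Q_def)
  obtain H where H: "H holomorphic_on A" "\<And>w. w \<in> A \<Longrightarrow> g w - l * F w = (w - a) * (w - b) * H w"
  proof (rule holomorphic_factor_two_zeros[of "\<lambda>w. g w - l * F w" A a b])
    show "(\<lambda>w. g w - l * F w) holomorphic_on A" by (intro holomorphic_intros g F)
  qed (use ab F g \<open>open A\<close> in \<open>auto simp: l_def\<close>)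
  \<comment> \<open>The radii \<alpha> and \<beta> bound two closed collars \<open>L\<close> and
    \<open>U\<close> of the boundary circles that contain neither \<open>a\<close> nor
    \<open>b\<close>, so \<open>P\<close> and \<open>Q\<close> are continuous there up to the
    boundary.\<close>
  define \<alpha> where "\<alpha> = (r + min (norm a) (norm b)) / 2"
  define \<beta> where "\<beta> = (1 + max (norm a) (norm b)) / 2"
  have \<alpha>: "r < \<alpha>" "\<alpha> < norm a" "\<alpha> < norm b" and \<beta>: "\<beta> < 1" "norm a < \<beta>" "norm b < \<beta>"
    using ab by (auto simp: \<alpha>_def \<beta>_def A_def)
  define L where "L = {w::complex. r \<le> norm w \<and> norm w \<le> \<alpha>}"
  define U where "U = {w::complex. \<beta> \<le> norm w \<and> norm w \<le> 1}"
  have sub: "L \<subseteq> C" "U \<subseteq> C"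
    using \<alpha> \<beta> ab by (auto simp: L_def U_def C_def A_def)
  have ne: "w \<noteq> a" "w \<noteq> b" if "w \<in> L \<or> w \<in> U" for w
    using that \<alpha> \<beta> by (auto simp: L_def U_def)
  have contQ: "continuous_on L Q" "continuous_on U Q"
    unfolding Q_def using sub ne
    by (auto intro!: continuous_intros continuous_on_subset[OF R(1)])
  have contP: "continuous_on L P" "continuous_on U P"
    unfolding PQ [abs_def] using sub
    by (auto intro!: continuous_on_mult contQ continuous_on_subset[OF F(1)])
  note contN = continuous_on_norm[OF contQ(1)] continuous_on_norm[OF contQ(2)]
  have mean: "circle_mean (\<lambda>w. H w * R w) \<rho> = circle_mean (\<lambda>w. g w * Q w) \<rho> - l * circle_mean P \<rho>
      \<and> norm (circle_mean (\<lambda>w. g w * Q w) \<rho>) \<le> circle_mean (\<lambda>w. norm (Q w)) \<rho>"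
    if \<rho>: "r < \<rho>" "\<rho> < 1" "sphere 0 \<rho> \<subseteq> L \<or> sphere 0 \<rho> \<subseteq> U" for \<rho>
  proof
    have "\<rho> > 0" using \<rho> \<open>0 < r\<close> by simp
    have SA: "sphere 0 \<rho> \<subseteq> A" using \<rho> by (auto simp: A_def)
    have contg: "continuous_on (sphere 0 \<rho>) g"
      using holomorphic_on_imp_continuous_on[OF g(1)] SA continuous_on_subset by blast
    have c: "continuous_on (sphere 0 \<rho>) Q" "continuous_on (sphere 0 \<rho>) P"
      using \<rho>(3) contQ contP continuous_on_subset by blast+
    have "circle_mean (\<lambda>w. H w * R w) \<rho> = circle_mean (\<lambda>w. g w * Q w - l * P w) \<rho>"
    proof (rule circle_mean_cong)
      fix w :: complex assume w: "norm w = \<rho>"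
      then have "w \<in> A" "w \<noteq> a" "w \<noteq> b" using \<rho> ne[of w] SA by auto
      then have "H w = (g w - l * F w) / ((w - a) * (w - b))" using H(2) by simp
      then have "H w * R w = (g w - l * F w) * Q w" by (simp add: Q_def)
      then show "H w * R w = g w * Q w - l * P w"
        unfolding PQ by (simp add: algebra_simps)
    qed (use \<open>\<rho> > 0\<close> in simp)
    also have "\<dots> = circle_mean (\<lambda>w. g w * Q w) \<rho> - l * circle_mean P \<rho>"
      using c contg \<open>\<rho> > 0\<close> by (intro circle_mean_diff_cmul continuous_intros) auto
    finally show "circle_mean (\<lambda>w. H w * R w) \<rho> = circle_mean (\<lambda>w. g w * Q w) \<rho> - l * circle_mean P \<rho>" .
    show "norm (circle_mean (\<lambda>w. g w * Q w) \<rho>) \<le> circle_mean (\<lambda>w. norm (Q w)) \<rho>"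
      using c contg \<open>\<rho> > 0\<close> g(2) SA
      by (intro norm_circle_mean_le continuous_intros) (auto simp: norm_mult intro!: mult_left_le_one_le)
  qed
  \<comment> \<open>The radii stay strictly inside the annulus because \<open>g\<close> need not
    extend to the boundary; after the bound on \<open>g\<close>, only \<open>P\<close> and
    \<open>Q\<close> remain, and these do extend.\<close>
  have key: "norm l * norm (circle_mean P \<rho>1 - circle_mean P \<rho>2) \<le>
      circle_mean (\<lambda>w. norm (Q w)) \<rho>1 + circle_mean (\<lambda>w. norm (Q w)) \<rho>2"
    if "r < \<rho>1" "\<rho>1 \<le> \<alpha>" "\<beta> \<le> \<rho>2" "\<rho>2 < 1" for \<rho>1 \<rho>2
  proof -
    have less: "\<rho>1 < \<rho>2" using that \<alpha> \<beta> by linarith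
    have "(\<lambda>w. H w * R w) holomorphic_on {w. r < norm w \<and> norm w < 1}"
      using H R by (auto intro: holomorphic_on_mult simp: A_def)
    then have "circle_mean (\<lambda>w. H w * R w) \<rho>1 = circle_mean (\<lambda>w. H w * R w) \<rho>2"
      using that less \<open>0 < r\<close> by (intro circle_mean_const) auto
    moreover have "sphere 0 \<rho>1 \<subseteq> L" "sphere 0 \<rho>2 \<subseteq> U" using that by (auto simp: L_def U_def)
    ultimately have *: "l * (circle_mean P \<rho>1 - circle_mean P \<rho>2) =
        circle_mean (\<lambda>w. g w * Q w) \<rho>1 - circle_mean (\<lambda>w. g w * Q w) \<rho>2"
      and le: "norm (circle_mean (\<lambda>w. g w * Q w) \<rho>1) \<le> circle_mean (\<lambda>w. norm (Q w)) \<rho>1"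
        "norm (circle_mean (\<lambda>w. g w * Q w) \<rho>2) \<le> circle_mean (\<lambda>w. norm (Q w)) \<rho>2"
      using mean[of \<rho>1] mean[of \<rho>2] that less by (auto simp: algebra_simps)
    show ?thesis
      unfolding norm_mult [symmetric] *
      using norm_triangle_ineq4 le by (smt (verit, best))
  qed
  \<comment> \<open>Radii that start at \<alpha> and \<beta>, stay in the two collars and tend to
    the boundary radii.\<close>
  define s1 where "s1 = (\<lambda>n. r + (\<alpha> - r) * inverse (real (Suc n)))"
  define s2 where "s2 = (\<lambda>n. 1 - (1 - \<beta>) * inverse (real (Suc n)))"
  have s1: "r < s1 n" "s1 n \<le> \<alpha>" and s2: "\<beta> \<le> s2 n" "s2 n < 1" for n
  proof -
    have "0 < inverse (real (Suc n))" "inverse (real (Suc n)) \<le> 1"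
      by (auto simp: inverse_le_1_iff)
    then have "0 < (\<alpha> - r) * inverse (real (Suc n))" "(\<alpha> - r) * inverse (real (Suc n)) \<le> \<alpha> - r"
      "0 < (1 - \<beta>) * inverse (real (Suc n))" "(1 - \<beta>) * inverse (real (Suc n)) \<le> 1 - \<beta>"
      using \<alpha> \<beta> by (auto intro: mult_left_le simp del: of_nat_Suc)
    then show "r < s1 n" "s1 n \<le> \<alpha>" "\<beta> \<le> s2 n" "s2 n < 1" by (auto simp: s1_def s2_def)
  qed
  have lim1: "s1 \<longlonglongrightarrow> r"
    unfolding s1_def by (rule tendsto_eq_intros LIMSEQ_inverse_real_of_nat refl | simp)+
  have lim2: "s2 \<longlonglongrightarrow> 1"
    unfolding s2_def by (rule tendsto_eq_intros LIMSEQ_inverse_real_of_nat refl | simp)+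
  have cm1: "(\<lambda>n. circle_mean f (s1 n)) \<longlonglongrightarrow> circle_mean f r"
    if "continuous_on L f" for f :: "complex \<Rightarrow> 'b::euclidean_space"
    using \<open>0 < r\<close> s1 \<alpha> that less_imp_le[OF s1(1)]
    by (intro continuous_on_tendsto_compose[OF circle_mean_continuous[of r \<alpha>] lim1])
      (auto simp: L_def)
  have cm2: "(\<lambda>n. circle_mean f (s2 n)) \<longlonglongrightarrow> circle_mean f 1"
    if "continuous_on U f" for f :: "complex \<Rightarrow> 'b::euclidean_space"
  proof (rule continuous_on_tendsto_compose[OF circle_mean_continuous[of \<beta> 1] lim2])
    show "0 \<le> \<beta>" using \<beta>(2) norm_ge_zero[of a] by linarith
  qed (use s2 \<beta> that less_imp_le[OF s2(2)] in \<open>auto simp: U_def\<close>)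
  have "norm l * norm (circle_mean P r - circle_mean P 1) \<le>
      circle_mean (\<lambda>w. norm (Q w)) r + circle_mean (\<lambda>w. norm (Q w)) 1"
  proof (rule LIMSEQ_le)
    show "(\<lambda>n. norm l * norm (circle_mean P (s1 n) - circle_mean P (s2 n))) \<longlonglongrightarrow>
        norm l * norm (circle_mean P r - circle_mean P 1)"
      by (intro tendsto_intros cm1 cm2 contP)
    show "(\<lambda>n. circle_mean (\<lambda>w. norm (Q w)) (s1 n) + circle_mean (\<lambda>w. norm (Q w)) (s2 n)) \<longlonglongrightarrow>
        circle_mean (\<lambda>w. norm (Q w)) r + circle_mean (\<lambda>w. norm (Q w)) 1"
      by (intro tendsto_intros cm1 cm2 contN)
  qed (use key s1 s2 in auto)
  moreover have cN: "continuous_on (sphere 0 r) (\<lambda>w. norm (Q w))" "continuous_on (sphere 0 1) (\<lambda>w. norm (Q w))"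
    using \<alpha> \<beta> by (auto intro: continuous_on_subset[OF contN(1)] simp: L_def)
      (auto intro: continuous_on_subset[OF contN(2)] simp: U_def)
  \<comment> \<open>As \<open>F\<close> is unimodular on the boundary, |P| = |Q| there, and the
    prescribed sign determines \<open>P\<close>.\<close>
  have Pin: "P w = of_real (norm (Q w)) \<and> norm (Q w) > 0" if "norm w = r" for w
    using inner[OF that] by (auto simp: PQ) (metis abs_of_pos mult.left_neutral norm_mult norm_of_real)+
  have Pout: "P w = - of_real (norm (Q w)) \<and> norm (Q w) > 0" if "norm w = 1" for w
    using outer[OF that] by (auto simp: PQ) (metis abs_of_pos mult.left_neutral norm_mult norm_of_real norm_minus_cancel)+
  have "circle_mean P r = of_real (circle_mean (\<lambda>w. norm (Q w)) r)"
    using Pin \<open>0 < r\<close> cN by (subst circle_mean_of_real[symmetric]) (auto intro: circle_mean_cong)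
  moreover have "circle_mean P 1 = - of_real (circle_mean (\<lambda>w. norm (Q w)) 1)"
  proof -
    have "circle_mean P 1 = circle_mean (\<lambda>w. - of_real (norm (Q w))) 1"
      using Pout by (intro circle_mean_cong) auto
    also have "\<dots> = - circle_mean (\<lambda>w. of_real (norm (Q w))) 1"
      by (simp add: circle_mean_def)
    finally show ?thesis using cN by (simp add: circle_mean_of_real)
  qed
  moreover have pos: "circle_mean (\<lambda>w. norm (Q w)) r > 0" "circle_mean (\<lambda>w. norm (Q w)) 1 > 0"
    using Pin Pout cN \<open>0 < r\<close> by (auto intro!: circle_mean_pos)
  \<comment> \<open>The opposite signs turn the difference of the means of \<open>P\<close> into the
    sum of the means of |Q|, which is also the right-hand side.\<close>
  ultimately have "norm l * (circle_mean (\<lambda>w. norm (Q w)) r + circle_mean (\<lambda>w. norm (Q w)) 1) \<le>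
      1 * (circle_mean (\<lambda>w. norm (Q w)) r + circle_mean (\<lambda>w. norm (Q w)) 1)"
    by (simp flip: of_real_add)
  then have "norm l \<le> 1"
    using pos by (subst (asm) mult_le_cancel_right) auto
  then show ?thesis using F(4) by (simp add: l_def norm_divide divide_le_eq_1)
qed

section \<open>The Poincare distance\<close>

lemma tanh_artanh_real:
  assumes "\<bar>x\<bar> < 1"
  shows "tanh (artanh x) = (x::real)"
proof -
  have pos: "(1 + x) / (1 - x) > 0" using assms by auto
  have "exp (- 2 * artanh x) = (1 - x) / (1 + x)"
    using pos by (simp add: artanh_def exp_minus)
  then show ?thesis
    using assms by (simp only: tanh_real_altdef) (simp add: field_simps abs_less_iff)
qed

lemma artanh_mono:
  fixes x y :: real
  assumes "-1 < x" "x \<le> y" "y < 1"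
  shows "artanh x \<le> artanh y"
proof -
  have "tanh (artanh x) \<le> tanh (artanh y)"
    using assms by (simp add: tanh_artanh_real)
  then show ?thesis by simp
qed

lemma has_real_derivative_two_artanh:
  fixes x :: real
  assumes "\<bar>x\<bar> < 1"
  shows "((\<lambda>x. 2 * artanh x) has_real_derivative 2 / (1 - x\<^sup>2)) (at x)"
proof -
  have x: "-1 < x" "x < 1" using assms by auto
  have "x\<^sup>2 \<noteq> 1" using x by (auto simp: power2_eq_1_iff)
  then show ?thesis
    unfolding artanh_def using x
    by (auto intro!: derivative_eq_intros simp: divide_simps power2_eq_square) (simp add: algebra_simps)
qed

lemma disk_length_nonneg:
  assumes "path_image \<gamma> \<subseteq> unit_disk"
  shows "0 \<le> disk_length \<gamma>"
  unfolding disk_length_def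
\<comment> \<open>Without regularity of \<gamma> the integrand may fail to be integrable; then
  \<open>integral\<close> has the default value 0.\<close>
proof (cases "(\<lambda>t. 2 / (1 - (norm (\<gamma> t))\<^sup>2) * norm (vector_derivative \<gamma> (at t))) integrable_on {0..1}")
  case True
  then show "0 \<le> integral {0..1} (\<lambda>t. 2 / (1 - (norm (\<gamma> t))\<^sup>2) * norm (vector_derivative \<gamma> (at t)))"
  proof (rule integral_nonneg)
    fix t :: real assume "t \<in> {0..1}"
    then have "norm (\<gamma> t) < 1" using assms by (auto simp: path_image_def image_subset_iff)
    then have "(norm (\<gamma> t))\<^sup>2 \<le> 1" by (simp add: power_le_one)
    then show "0 \<le> 2 / (1 - (norm (\<gamma> t))\<^sup>2) * norm (vector_derivative \<gamma> (at t))" by simp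
  qed
qed (simp add: not_integrable_integral)

lemma poincare_dist_le_disk_length:
  assumes "\<gamma> C1_differentiable_on {0..1}" "path_image \<gamma> \<subseteq> unit_disk"
  shows "poincare_dist (pathstart \<gamma>) (pathfinish \<gamma>) \<le> disk_length \<gamma>"
  unfolding poincare_dist_def
  by (rule cInf_lower) (use assms disk_length_nonneg in \<open>auto intro!: bdd_belowI[of _ 0]\<close>)

text \<open>The bound is the length of the geodesic from \<open>u\<close> to \<open>v\<close>, the
  image of the segment from 0 to \<open>e\<close> under the disk automorphism that takes 0 to
  \<open>u\<close>.\<close>

lemma poincare_dist_le:
  assumes u: "norm u < 1" and v: "norm v < 1"
  shows "poincare_dist u v \<le> 2 * artanh (norm (Moebius_function 0 u v))"
proof -
  define e where "e = Moebius_function 0 u v"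
  have e: "norm e < 1" unfolding e_def by (rule Moebius_function_norm_lt_1[OF u v])
  have te: "norm (of_real t * e) < 1" if "t \<in> {0..1}" for t :: real
    using e that mult_left_le_one_le[of "norm e" t] by (simp add: norm_mult)
  have small: "norm (cnj u * (of_real t * e)) < 1" if "t \<in> {0..1}" for t :: real
    unfolding norm_mult[of "cnj u"] complex_mod_cnj
    using u te[OF that] norm_ge_zero[of u] norm_ge_zero[of "of_real t * e"]
      mult_le_one[of "norm u" "norm (of_real t * e)"] mult_strict_mono'[of "norm u" 1 "norm (of_real t * e)" 1]
    by simp
  have nz: "1 + cnj u * (of_real t * e) \<noteq> 0" if "t \<in> {0..1}" for t :: real
    using small[OF that] by (metis add_eq_0_iff2 less_irrefl norm_minus_cancel norm_one)
  define \<gamma> where "\<gamma> = (\<lambda>t. (of_real t * e + u) / (1 + cnj u * (of_real t * e)))"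
  define D where "D = (\<lambda>t. e * (1 - cnj u * u) / (1 + cnj u * (of_real t * e))\<^sup>2)"
  have deriv: "(\<gamma> has_vector_derivative D t) (at t)" if "t \<in> {0..1}" for t
  proof -
    have "((\<lambda>z. (z * e + u) / (1 + cnj u * (z * e))) has_field_derivative D t) (at (of_real t))"
      using nz[OF that] unfolding D_def
      by (auto intro!: derivative_eq_intros simp: power2_eq_square divide_simps) (simp add: algebra_simps)
    then show ?thesis
      unfolding \<gamma>_def using has_vector_derivative_real_field by blast
  qed
  \<comment> \<open>The standard identity for disk automorphisms; the denominators cancel in the
    length element, which becomes that of the segment.\<close>
  have norm\<gamma>: "1 - (norm (\<gamma> t))\<^sup>2 =
      (1 - (norm u)\<^sup>2) * (1 - (t * norm e)\<^sup>2) / (norm (1 + cnj u * (of_real t * e)))\<^sup>2" if "t \<in> {0..1}" for t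
  proof -
    define x where "x = of_real t * e"
    have nz': "1 + cnj u * x \<noteq> 0" using nz[OF that] by (simp add: x_def)
    have "complex_of_real ((norm (1 + cnj u * x))\<^sup>2 - (norm (x + u))\<^sup>2) =
        of_real ((1 - (norm u)\<^sup>2) * (1 - (norm x)\<^sup>2))"
      by (simp only: of_real_diff of_real_mult of_real_1 complex_norm_square) (simp add: algebra_simps)
    then have "(norm (1 + cnj u * x))\<^sup>2 - (norm (x + u))\<^sup>2 = (1 - (norm u)\<^sup>2) * (1 - (norm x)\<^sup>2)"
      by (simp only: of_real_eq_iff)
    moreover have "(norm x)\<^sup>2 = (t * norm e)\<^sup>2" by (simp add: x_def norm_mult power_mult_distrib)
    ultimately show ?thesis
      using nz' unfolding \<gamma>_def x_def[symmetric] by (simp add: norm_divide power_divide field_simps)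
  qed
  have img: "path_image \<gamma> \<subseteq> unit_disk"
  proof
    fix w assume "w \<in> path_image \<gamma>"
    then obtain t where t: "t \<in> {0..1}" and w: "w = \<gamma> t" by (auto simp: path_image_def)
    have "t * norm e < 1" "0 \<le> t * norm e" using te[OF t] t by (auto simp: norm_mult)
    then have "(t * norm e)\<^sup>2 < 1" "(norm u)\<^sup>2 < 1" using u by (auto simp: abs_square_less_1)
    then have "1 - (norm (\<gamma> t))\<^sup>2 > 0"
      unfolding norm\<gamma>[OF t] using nz[OF t] by (intro divide_pos_pos mult_pos_pos) auto
    then show "w \<in> unit_disk" by (simp add: w abs_square_less_1)
  qed
  have C1: "\<gamma> C1_differentiable_on {0..1}"
    unfolding C1_differentiable_on_def
  proof (intro exI conjI ballI)
    show "continuous_on {0..1} D" unfolding D_def using nz by (intro continuous_intros) auto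
  qed (rule deriv)
  have ends: "pathstart \<gamma> = u" "pathfinish \<gamma> = v"
  proof -
    show "pathstart \<gamma> = u" by (simp add: pathstart_def \<gamma>_def)
    have 1: "1 - cnj u * v \<noteq> 0"
      using u v norm_mult[of "cnj u" v] mult_strict_mono'[of "norm u" 1 "norm v" 1]
      by (metis complex_mod_cnj eq_iff_diff_eq_0 less_irrefl mult_1 norm_ge_zero norm_one)
    have 2: "1 + cnj u * e \<noteq> 0" using nz[of 1] by simp
    have "e * (1 - cnj u * v) = v - u" unfolding e_def Moebius_function_simple using 1 by simp
    then have "e + u = v * (1 + cnj u * e)" by (simp add: algebra_simps)
    then show "pathfinish \<gamma> = v" using 2 by (simp add: pathfinish_def \<gamma>_def)
  qed
  have "disk_length \<gamma> = integral {0..1} (\<lambda>t. norm e * (2 / (1 - (t * norm e)\<^sup>2)))"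
    unfolding disk_length_def
  proof (intro integral_cong)
    fix t :: real assume t: "t \<in> {0..1}"
    have pos: "1 - (norm u)\<^sup>2 > 0" using u by (simp add: abs_square_less_1)
    have "norm (1 - cnj u * u) = 1 - (norm u)\<^sup>2"
    proof -
      have "1 - cnj u * u = of_real (1 - (norm u)\<^sup>2)"
        by (simp add: complex_norm_square[symmetric] mult.commute del: of_real_power)
      then show ?thesis using pos by (simp only: norm_of_real abs_of_pos)
    qed
    then have "norm (vector_derivative \<gamma> (at t)) =
        norm e * (1 - (norm u)\<^sup>2) / (norm (1 + cnj u * (of_real t * e)))\<^sup>2"
      unfolding vector_derivative_at[OF deriv[OF t]] D_def by (simp add: norm_divide norm_mult norm_power)
    moreover have "2 / (A * B / C) * (E * A / C) = E * (2 / B)" if "A \<noteq> 0" "C \<noteq> 0" for A B C E :: real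
      using that by (cases "B = 0") (simp_all add: field_simps)
    ultimately show "2 / (1 - (norm (\<gamma> t))\<^sup>2) * norm (vector_derivative \<gamma> (at t)) =
        norm e * (2 / (1 - (t * norm e)\<^sup>2))"
      using pos nz[OF t] unfolding norm\<gamma>[OF t] by simp
  qed
  also have "\<dots> = 2 * artanh (1 * norm e) - 2 * artanh (0 * norm e)"
  proof (intro integral_unique fundamental_theorem_of_calculus)
    fix t :: real assume t: "t \<in> {0..1}"
    have "\<bar>t * norm e\<bar> < 1" using te[OF t] by (simp add: norm_mult abs_mult)
    then have "((\<lambda>x. 2 * artanh x) has_real_derivative 2 / (1 - (t * norm e)\<^sup>2)) (at (t * norm e))"
      by (rule has_real_derivative_two_artanh)
    moreover have "((\<lambda>t. t * norm e) has_real_derivative norm e) (at t)"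
      by (auto intro!: derivative_eq_intros)
    ultimately have "((\<lambda>t. 2 * artanh (t * norm e)) has_real_derivative
        (2 / (1 - (t * norm e)\<^sup>2)) * norm e) (at t)"
      by (rule DERIV_chain2)
    then show "((\<lambda>t. 2 * artanh (t * norm e)) has_vector_derivative
        norm e * (2 / (1 - (t * norm e)\<^sup>2))) (at t within {0..1})"
      by (simp add: has_real_derivative_iff_has_vector_derivative[symmetric] mult.commute
          has_field_derivative_at_within)
  qed simp
  finally have "disk_length \<gamma> = 2 * artanh (norm e)" by simp
  then show ?thesis
    using poincare_dist_le_disk_length[OF C1 img] by (simp add: ends e_def)
qed

text \<open>Projecting a curve to the real axis decreases both the density and the speed. The
  projected curve runs from \<open>p\<close> to a nonpositive point, so its length is at least that
  from \<open>p\<close> to 0.\<close>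

lemma poincare_dist_ge:
  assumes p: "0 \<le> p" "p < 1" and v: "norm v < 1" "Re v \<le> 0"
  shows "2 * artanh p \<le> poincare_dist (of_real p) v"
  unfolding poincare_dist_def
proof (rule cInf_greatest)
  \<comment> \<open>The segment shows that the set of lengths is nonempty, without which its infimum
    could not be bounded below.\<close>
  have "linepath (of_real p) v C1_differentiable_on {0..1}"
    unfolding C1_differentiable_on_def
    by (intro exI[of _ "\<lambda>_. v - of_real p"]) (auto intro: has_vector_derivative_linepath_within)
  moreover have "path_image (linepath (of_real p) v) \<subseteq> unit_disk"
    using p v by (simp add: closed_segment_subset)
  ultimately show "{disk_length \<gamma> |\<gamma>. \<gamma> C1_differentiable_on {0..1} \<and> path_image \<gamma> \<subseteq> unit_disk \<and>
      pathstart \<gamma> = complex_of_real p \<and> pathfinish \<gamma> = v} \<noteq> {}"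
    by (auto intro!: exI[of _ "linepath (of_real p) v"])
next
  fix x assume "x \<in> {disk_length \<gamma> |\<gamma>. \<gamma> C1_differentiable_on {0..1} \<and> path_image \<gamma> \<subseteq> unit_disk \<and>
      pathstart \<gamma> = complex_of_real p \<and> pathfinish \<gamma> = v}"
  then obtain \<gamma> where x: "x = disk_length \<gamma>" and C1: "\<gamma> C1_differentiable_on {0..1}"
    and img: "path_image \<gamma> \<subseteq> unit_disk" and ends: "\<gamma> 0 = of_real p" "\<gamma> 1 = v"
    by (auto simp: pathstart_def pathfinish_def)
  have less: "norm (\<gamma> t) < 1" if "t \<in> {0..1}" for t
    using img that by (auto simp: path_image_def image_subset_iff)
  obtain D where D: "\<And>t. t \<in> {0..1} \<Longrightarrow> (\<gamma> has_vector_derivative D t) (at t)" "continuous_on {0..1} D"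
    using C1 unfolding C1_differentiable_on_def by blast
  have c\<gamma>: "continuous_on {0..1} \<gamma>"
    by (intro continuous_at_imp_continuous_on ballI has_vector_derivative_continuous[OF D(1)])
  have sq: "(norm (\<gamma> t))\<^sup>2 < 1" if "t \<in> {0..1}" for t
    using less[OF that] by (simp add: abs_square_less_1)
  have Re2: "(Re (\<gamma> t))\<^sup>2 \<le> (norm (\<gamma> t))\<^sup>2" for t
    using abs_Re_le_cmod[of "\<gamma> t"] by (simp add: abs_le_square_iff[symmetric])
  have int: "((\<lambda>t. 2 / (1 - (Re (\<gamma> t))\<^sup>2) * Re (D t)) has_integral
      2 * artanh (Re (\<gamma> 1)) - 2 * artanh (Re (\<gamma> 0))) {0..1}"
  proof (rule fundamental_theorem_of_calculus)
    fix t :: real assume t: "t \<in> {0..1}"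
    have "\<bar>Re (\<gamma> t)\<bar> < 1" using less[OF t] abs_Re_le_cmod[of "\<gamma> t"] by linarith
    then have "((\<lambda>x. 2 * artanh x) has_real_derivative 2 / (1 - (Re (\<gamma> t))\<^sup>2)) (at (Re (\<gamma> t)))"
      by (rule has_real_derivative_two_artanh)
    moreover have "((\<lambda>t. Re (\<gamma> t)) has_real_derivative Re (D t)) (at t)"
      using D(1)[OF t] unfolding has_real_derivative_iff_has_vector_derivative
      by (rule bounded_linear.has_vector_derivative[OF bounded_linear_Re])
    ultimately have "((\<lambda>t. 2 * artanh (Re (\<gamma> t))) has_real_derivative
        (2 / (1 - (Re (\<gamma> t))\<^sup>2)) * Re (D t)) (at t)"
      by (rule DERIV_chain2)
    then show "((\<lambda>t. 2 * artanh (Re (\<gamma> t))) has_vector_derivative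
        2 / (1 - (Re (\<gamma> t))\<^sup>2) * Re (D t)) (at t within {0..1})"
      by (simp add: has_real_derivative_iff_has_vector_derivative[symmetric] has_field_derivative_at_within)
  qed simp
  have len: "disk_length \<gamma> = integral {0..1} (\<lambda>t. 2 / (1 - (norm (\<gamma> t))\<^sup>2) * norm (D t))"
    unfolding disk_length_def
    by (intro integral_cong) (simp only: vector_derivative_at[OF D(1)])
  have "- (2 * artanh (Re (\<gamma> 1)) - 2 * artanh (Re (\<gamma> 0))) \<le> disk_length \<gamma>"
    unfolding len
  proof (rule has_integral_le[OF has_integral_neg[OF int] integrable_integral])
    show "(\<lambda>t. 2 / (1 - (norm (\<gamma> t))\<^sup>2) * norm (D t)) integrable_on {0..1}"
      using sq by (intro integrable_continuous_real continuous_intros D(2) c\<gamma>) fastforce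
    fix t :: real assume t: "t \<in> {0..1}"
    have "- (2 / (1 - (Re (\<gamma> t))\<^sup>2) * Re (D t)) = 2 / (1 - (Re (\<gamma> t))\<^sup>2) * (- Re (D t))" by simp
    also have "\<dots> \<le> 2 / (1 - (Re (\<gamma> t))\<^sup>2) * norm (D t)"
      using sq[OF t] Re2[of t] abs_Re_le_cmod[of "D t"] by (intro mult_left_mono) auto
    also have "\<dots> \<le> 2 / (1 - (norm (\<gamma> t))\<^sup>2) * norm (D t)"
      using sq[OF t] Re2[of t] by (intro mult_right_mono divide_left_mono mult_pos_pos) auto
    finally show "- (2 / (1 - (Re (\<gamma> t))\<^sup>2) * Re (D t)) \<le> 2 / (1 - (norm (\<gamma> t))\<^sup>2) * norm (D t)" .
  qed
  moreover have "artanh (Re (\<gamma> 1)) \<le> artanh 0"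
    using v abs_Re_le_cmod[of v] unfolding ends by (intro artanh_mono) auto
  ultimately show "2 * artanh p \<le> x" by (simp add: x ends)
qed

section \<open>Caratheodory balls in the annulus\<close>

lemma unit_annulus_eq: "unit_annulus r = ball 0 1 - cball 0 r"
  by (auto simp: unit_annulus_def)

lemma open_unit_annulus: "open (unit_annulus r)"
  by (simp add: unit_annulus_eq open_Diff)

lemma caratheodory_dist_ge:
  assumes "f holomorphic_on X" "f ` X \<subseteq> unit_disk" "z \<in> X" "w \<in> X"
    and "f z = of_real p" "0 \<le> p" "Re (f w) \<le> 0"
  shows "ereal (2 * artanh p) \<le> caratheodory_dist X z w"
proof -
  have "norm (f z) < 1" "norm (f w) < 1" using assms by (auto simp: image_subset_iff)
  then have "2 * artanh p \<le> poincare_dist (f z) (f w)"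
    using assms poincare_dist_ge[of p "f w"] by simp
  also have "ereal (poincare_dist (f z) (f w)) \<le> caratheodory_dist X z w"
    unfolding caratheodory_dist_def using assms by (intro Sup_upper CollectI exI[of _ f]) auto
  finally show ?thesis by simp
qed

text \<open>Composing a competitor with the disk automorphism that takes its value at
  \<open>w\<close> to 0 reduces the bound to functions vanishing at \<open>w\<close>.\<close>

lemma caratheodory_dist_le:
  assumes "\<And>g. g holomorphic_on X \<Longrightarrow> g ` X \<subseteq> unit_disk \<Longrightarrow> g w = 0 \<Longrightarrow> norm (g z) \<le> M"
    and "M < 1" "z \<in> X" "w \<in> X"
  shows "caratheodory_dist X z w \<le> ereal (2 * artanh M)"
  unfolding caratheodory_dist_def
proof (rule Sup_least, clarify)
  fix f assume f: "f holomorphic_on X" "f ` X \<subseteq> unit_disk"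
  then have n: "norm (f z) < 1" "norm (f w) < 1" using assms by (auto simp: image_subset_iff)
  define g where "g = Moebius_function 0 (f w) \<circ> f"
  have "g holomorphic_on X"
    unfolding g_def using n f
    by (intro holomorphic_on_compose_gen[OF f(1) Moebius_function_holomorphic f(2)])
  moreover have "g ` X \<subseteq> unit_disk"
    using f n(2) by (auto simp: g_def image_subset_iff intro!: Moebius_function_norm_lt_1)
  moreover have "g w = 0" by (simp add: g_def Moebius_function_eq_zero)
  ultimately have "norm (g z) \<le> M" by (rule assms(1))
  have "norm (Moebius_function 0 (f z) (f w)) = norm (g z)"
  proof -
    have "norm (1 - cnj (f z) * f w) = norm (cnj (1 - cnj (f z) * f w))"
      by (simp only: complex_mod_cnj)
    also have "\<dots> = norm (1 - cnj (f w) * f z)" by (simp add: mult.commute)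
    finally show ?thesis
      by (simp add: g_def Moebius_function_simple norm_divide norm_minus_commute)
  qed
  then have "poincare_dist (f z) (f w) \<le> 2 * artanh (norm (g z))"
    using poincare_dist_le[OF n] by simp
  also have "\<dots> \<le> 2 * artanh M"
    using artanh_mono[of "norm (g z)" M] \<open>norm (g z) \<le> M\<close> \<open>M < 1\<close> norm_ge_zero[of "g z"] by linarith
  finally show "ereal (poincare_dist (f z) (f w)) \<le> ereal (2 * artanh M)" by simp
qed

section \<open>Conformal disks in the annulus and the Fridman function\<close>

text \<open>After rotation by \<open>u\<close>, the principal logarithm takes the annulus slit along
  the radius opposite to \<open>u\<close> onto an open rectangle, to which the Riemann mapping
  theorem applies.\<close>

lemma slit_annulus_conformal:
  assumes "0 < r" "r < 1" "norm u = 1"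
  obtains f where "f holomorphic_on unit_disk" "inj_on f unit_disk"
    "f ` unit_disk \<subseteq> unit_annulus r"
    "\<And>w. w \<in> unit_annulus r \<Longrightarrow> (\<And>t. 0 < t \<Longrightarrow> w \<noteq> - of_real t * u) \<Longrightarrow> w \<in> f ` unit_disk"
proof -
  define S where "S = box (Complex (ln r) (- pi)) (Complex 0 pi)"
  have S: "\<zeta> \<in> S \<longleftrightarrow> ln r < Re \<zeta> \<and> Re \<zeta> < 0 \<and> - pi < Im \<zeta> \<and> Im \<zeta> < pi" for \<zeta>
    by (auto simp: S_def in_box_complex_iff)
  have u0: "u \<noteq> 0" using assms by auto
  have "open S" by (simp add: S_def open_box)
  moreover have "simply_connected S"
    unfolding S_def by (intro convex_imp_simply_connected convex_box)
  \<comment> \<open>These two points rule out the exceptional cases of the empty set and the whole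
    plane.\<close>
  moreover have "Complex (ln r / 2) 0 \<in> S" "0 \<notin> S" using assms by (auto simp: S)
  ultimately obtain h k where h: "h holomorphic_on S" "\<And>x. x \<in> S \<Longrightarrow> h x \<in> unit_disk \<and> k (h x) = x"
    and k: "k holomorphic_on unit_disk" "\<And>x. x \<in> unit_disk \<Longrightarrow> k x \<in> S \<and> h (k x) = x"
    using simply_connected_eq_biholomorphic_to_disc[of S] by blast
  show ?thesis
  proof
    show "(\<lambda>x. u * exp (k x)) holomorphic_on unit_disk" by (intro holomorphic_intros k)
    show "inj_on (\<lambda>x. u * exp (k x)) unit_disk"
    proof
      fix x y assume xy: "x \<in> unit_disk" "y \<in> unit_disk" and "u * exp (k x) = u * exp (k y)"
      then have e: "exp (k x) = exp (k y)" using u0 by simp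
      have "k x \<in> S" "k y \<in> S" using k xy by auto
      then have "\<bar>Im (k x) - Im (k y)\<bar> < 2 * pi" by (auto simp: S)
      then have "k x = k y" using e by (rule exp_complex_eqI)
      then show "x = y" using k(2) xy by metis
    qed
    show "(\<lambda>x. u * exp (k x)) ` unit_disk \<subseteq> unit_annulus r"
    proof clarify
      fix x assume "x \<in> unit_disk"
      then have "k x \<in> S" using k by auto
      then have "ln r < Re (k x)" "Re (k x) < 0" by (auto simp: S)
      moreover from this have "exp (ln r) < exp (Re (k x))" by (simp only: exp_less_cancel_iff)
      ultimately show "u * exp (k x) \<in> unit_annulus r"
        using assms by (simp add: unit_annulus_def norm_mult)
    qed
    fix w assume w: "w \<in> unit_annulus r" and slit: "\<And>t. 0 < t \<Longrightarrow> w \<noteq> - of_real t * u"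
    define v where "v = w / u"
    have nv: "norm v = norm w" "w = u * v" using assms u0 by (auto simp: v_def norm_divide)
    then have v: "r < norm v" "norm v < 1" "v \<noteq> 0" using w assms by (auto simp: unit_annulus_def)
    have "ln v \<in> S"
      unfolding S
    proof (intro conjI)
      show "ln r < Re (ln v)" "Re (ln v) < 0" using v assms by auto
      show "- pi < Im (ln v)" using v by (simp add: mpi_less_Im_Ln)
      have "Im (ln v) \<noteq> pi"
      proof
        assume "Im (ln v) = pi"
        then have "Re v < 0" "Im v = 0" using v by (auto simp: Im_Ln_eq_pi)
        then have "v = - of_real (- Re v)" by (simp add: complex_eq_iff)
        then show False
          using slit[of "- Re v"] \<open>Re v < 0\<close> nv(2) by (metis mult.commute neg_0_less_iff_less)
      qed
      then show "Im (ln v) < pi" using Im_Ln_le_pi[OF v(3)] by simp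
    qed
    then have "w = u * exp (k (h (ln v)))" "h (ln v) \<in> unit_disk" using h v nv by auto
    then show "w \<in> (\<lambda>x. u * exp (k x)) ` unit_disk" by blast
  qed
qed

text \<open>The image is simply connected and omits 0, so a circle inside it would have winding
  number 0 about its centre.\<close>

lemma disk_image_misses_circle:
  assumes f: "f holomorphic_on unit_disk" "inj_on f unit_disk" and "0 \<notin> f ` unit_disk" "0 < \<rho>"
  shows "\<not> sphere 0 \<rho> \<subseteq> f ` unit_disk"
proof
  assume *: "sphere 0 \<rho> \<subseteq> f ` unit_disk"
  have op: "open (f ` unit_disk)" using open_mapping_thm3[OF f(1) _ f(2)] by simp
  obtain g where g: "g holomorphic_on f ` unit_disk" "\<And>z. z \<in> unit_disk \<Longrightarrow> g (f z) = z"
    using holomorphic_has_inverse[OF f(1) open_ball f(2)] by metis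
  have "simply_connected (f ` unit_disk)"
    unfolding simply_connected_eq_biholomorphic_to_disc[OF op]
    using f g by (intro disjI2 exI[of _ g] exI[of _ f]) auto
  then have "winding_number (circlepath 0 \<rho>) 0 = 0"
    using * assms by (intro simply_connected_imp_winding_number_zero) auto
  then show False using winding_number_circlepath_centre[OF \<open>0 < \<rho>\<close>, of 0] by simp
qed

text \<open>By \<open>lower\<close>, the open ball of radius \<open>2 * artanh M\<close> misses the
  slit and lies in a conformal disk, so \<open>M\<close> is attained. By \<open>upper\<close>, every
  larger ball contains a whole circle about 0.\<close>

lemma fridman_caratheodory_annulus_eqI:
  assumes r: "0 < r" "r < 1" and M: "0 < M" "M < 1" and u: "norm u = 1" and \<rho>: "r < \<rho>" "\<rho> < 1"
    and z: "z \<in> unit_annulus r"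
    and lower: "\<And>t. r < t \<Longrightarrow> t < 1 \<Longrightarrow> ereal (2 * artanh M) \<le> caratheodory_dist (unit_annulus r) z (- of_real t * u)"
    and upper: "\<And>w. norm w = \<rho> \<Longrightarrow> caratheodory_dist (unit_annulus r) z w \<le> ereal (2 * artanh M)"
  shows "fridman_caratheodory (unit_annulus r) z = M"
  unfolding fridman_caratheodory_def
proof (rule cSup_eq_maximum)
  have th: "tanh (artanh M) = M" using M by (intro tanh_artanh_real) auto
  then have "artanh M > 0" using M by (metis tanh_real_pos_iff)
  obtain f where f: "f holomorphic_on unit_disk" "inj_on f unit_disk" "f ` unit_disk \<subseteq> unit_annulus r"
    "\<And>w. w \<in> unit_annulus r \<Longrightarrow> (\<And>t. 0 < t \<Longrightarrow> w \<noteq> - of_real t * u) \<Longrightarrow> w \<in> f ` unit_disk"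
    using slit_annulus_conformal[OF r u] by blast
  have "caratheodory_ball (unit_annulus r) z (2 * artanh M) \<subseteq> f ` unit_disk"
  proof
    fix w assume w: "w \<in> caratheodory_ball (unit_annulus r) z (2 * artanh M)"
    show "w \<in> f ` unit_disk"
    proof (rule f(4))
      show wA: "w \<in> unit_annulus r" using w by (simp add: caratheodory_ball_def)
      show "w \<noteq> - of_real t * u" if "0 < t" for t
      proof
        assume weq: "w = - of_real t * u"
        then have "r < t" "t < 1" using wA that u by (auto simp: unit_annulus_def norm_mult)
        then show False using lower[of t] w weq by (auto simp: caratheodory_ball_def dest: leD)
      qed
    qed
  qed
  then show "M \<in> {tanh (s / 2) | s. s > 0 \<and>
            (\<exists>f. f holomorphic_on unit_disk \<and> inj_on f unit_disk \<and> f ` unit_disk \<subseteq> unit_annulus r \<and>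
                 caratheodory_ball (unit_annulus r) z s \<subseteq> f ` unit_disk)}"
    using f th \<open>artanh M > 0\<close> by (intro CollectI exI[of _ "2 * artanh M"]) auto
next
  fix x assume "x \<in> {tanh (s / 2) | s. s > 0 \<and>
            (\<exists>f. f holomorphic_on unit_disk \<and> inj_on f unit_disk \<and> f ` unit_disk \<subseteq> unit_annulus r \<and>
                 caratheodory_ball (unit_annulus r) z s \<subseteq> f ` unit_disk)}"
  then obtain s f where x: "x = tanh (s / 2)" and f: "f holomorphic_on unit_disk" "inj_on f unit_disk"
    "f ` unit_disk \<subseteq> unit_annulus r" and ball: "caratheodory_ball (unit_annulus r) z s \<subseteq> f ` unit_disk"
    by blast
  have th: "tanh (artanh M) = M" using M by (intro tanh_artanh_real) auto
  show "x \<le> M"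
  proof (rule ccontr)
    assume "\<not> x \<le> M"
    then have "tanh (artanh M) < tanh (s / 2)" using th x by simp
    then have s: "2 * artanh M < s" by simp
    have "sphere 0 \<rho> \<subseteq> caratheodory_ball (unit_annulus r) z s"
    proof
      fix w :: complex assume "w \<in> sphere 0 \<rho>"
      then have w: "norm w = \<rho>" by simp
      have "caratheodory_dist (unit_annulus r) z w < ereal s"
        using upper[OF w] s by (meson ereal_less(2) less_ereal.simps(1) order_le_less_trans)
      then show "w \<in> caratheodory_ball (unit_annulus r) z s"
        using w \<rho> by (simp add: caratheodory_ball_def unit_annulus_def)
    qed
    moreover have "0 \<notin> f ` unit_disk" using f(3) r by (auto simp: unit_annulus_def)
    ultimately show False
      using disk_image_misses_circle[OF f(1,2)] ball \<rho> r by (meson order.strict_trans order_trans)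
  qed
qed

text \<open>The range of \<open>x\<close> covers all quotients of a point of the closed annulus by a
  point of the open one, so \<open>x = 1\<close> gives the only zero of theta met below.\<close>

lemma jtheta_cofactor_nonzero:
  assumes "0 < q" "q < 1" "q < norm x" "q * norm x < 1"
  shows "qpoch q (of_real q * x) * qpoch q (of_real q / x) \<noteq> 0"
proof -
  have "x \<noteq> 0" using assms by auto
  then show ?thesis
    using assms qpoch_nonzero[of q "of_real q * x"] qpoch_nonzero[of q "of_real q / x"]
    by (auto simp: norm_mult norm_divide divide_less_eq)
qed

lemma jtheta_cofactor_holomorphic:
  assumes "0 < q" "q < 1" "f holomorphic_on A" "\<And>w. w \<in> A \<Longrightarrow> f w \<noteq> 0"
  shows "(\<lambda>w. qpoch q (of_real q * f w) * qpoch q (of_real q / f w)) holomorphic_on A"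
proof -
  have *: "(\<lambda>w. qpoch q (g w)) holomorphic_on A" if "g holomorphic_on A" for g
    using holomorphic_on_compose[OF that qpoch_holomorphic] assms by (simp add: o_def)
  show ?thesis
    using assms by (intro holomorphic_on_mult * holomorphic_on_divide holomorphic_on_const) auto
qed

section \<open>Extremal functions on the annulus\<close>

locale annulus =
  fixes r :: real
  assumes r: "0 < r" "r < 1"
begin

text \<open>The base is \<open>r\<^sup>2\<close> because the reflections in the two boundary circles
  compose to multiplication by \<open>r\<^sup>2\<close> or its inverse.\<close>

abbreviation \<theta> :: "complex \<Rightarrow> complex" where "\<theta> \<equiv> jtheta (r\<^sup>2)"

lemma r_bounds: "0 < r\<^sup>2" "r\<^sup>2 < 1" "sqrt r < 1" "r < sqrt r" "r\<^sup>2 < r"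
proof -
  show "sqrt r < 1" "0 < r\<^sup>2" using r by auto
  show "r < sqrt r" using r by (simp add: real_less_rsqrt power2_eq_square)
  show "r\<^sup>2 < 1" using r by (simp add: abs_square_less_1)
  show "r\<^sup>2 < r" using r by (simp add: power2_eq_square)
qed

text \<open>On the unit circle conjugation is inversion, so the conjugate of
  \<open>w * cnj b\<close> is the inverse of \<open>w / b\<close>.\<close>

lemma cnj_theta_outer:
  assumes "norm w = 1" "b \<noteq> 0"
  shows "\<theta> (w / b) = - (w / b) * cnj (\<theta> (w * cnj b))"
proof -
  have w: "w \<noteq> 0" using assms by auto
  have "cnj w * w = 1" using assms complex_norm_square[of w] by (simp add: mult.commute)
  then have cw: "cnj w = 1 / w" using w by (simp add: nonzero_eq_divide_eq)
  have "cnj (w * cnj b) = 1 / (w / b)" using cw by simp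
  then have "cnj (\<theta> (w * cnj b)) = \<theta> (1 / (w / b))"
    by (simp only: cnj_jtheta r_bounds)
  also have "\<dots> = - \<theta> (w / b) / (w / b)"
    using w assms by (intro jtheta_inverse r_bounds) auto
  finally show ?thesis using w assms by simp
qed

text \<open>On this circle \<open>cnj w\<close> is \<open>r\<^sup>2 / w\<close>, so the reflection
  formula for theta applies, now without an extra factor.\<close>

lemma cnj_theta_inner:
  assumes "norm w = r"
  shows "\<theta> (w / b) = cnj (\<theta> (w * cnj b))"
proof -
  have w: "w \<noteq> 0" using assms r by auto
  have "cnj w * w = of_real (r\<^sup>2)" using assms complex_norm_square[of w] by (simp add: mult.commute)
  then have "cnj w = of_real (r\<^sup>2) / w" using w by (simp add: nonzero_eq_divide_eq)
  then have "cnj (w * cnj b) = of_real (r\<^sup>2) / (w / b)" by simp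
  then have "cnj (\<theta> (w * cnj b)) = \<theta> (of_real (r\<^sup>2) / (w / b))"
    by (simp only: cnj_jtheta r_bounds)
  then show ?thesis by (simp only: jtheta_reflect r_bounds)
qed

lemma theta_outside_nonzero:
  assumes "r \<le> norm w" "norm w \<le> 1" "r < norm b" "norm b < 1"
  shows "\<theta> (w * cnj b) \<noteq> 0"
proof (rule jtheta_nonzero)
  show "r\<^sup>2 < norm (w * cnj b)"
    using assms r mult_le_less_imp_less[of r "norm w" r "norm b"]
    by (simp add: norm_mult power2_eq_square)
  show "norm (w * cnj b) < 1"
    using assms mult_left_le_one_le[of "norm b" "norm w"] by (simp add: norm_mult)
qed (rule r_bounds)+

lemma ratio_bounds:
  fixes w b :: complex
  assumes "r \<le> norm w" "norm w \<le> 1" "r < norm b" "norm b < 1"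
  shows "r\<^sup>2 < norm (w / b)" "r\<^sup>2 * norm (w / b) < 1"
proof -
  have b: "0 < norm b" using assms r by linarith
  have "r\<^sup>2 * norm b < r\<^sup>2" using r_bounds assms by simp
  then have "r\<^sup>2 * norm b < norm w" using r_bounds assms r by linarith
  then show "r\<^sup>2 < norm (w / b)" using b by (simp add: norm_divide field_simps)
  have "r\<^sup>2 * norm w \<le> r\<^sup>2" using r_bounds assms by (simp add: mult_left_le)
  then have "r\<^sup>2 * norm w < norm b" using r_bounds assms r by linarith
  then show "r\<^sup>2 * norm (w / b) < 1" using b by (simp add: norm_divide field_simps)
qed

lemma theta_inside_nonzero:
  assumes "r \<le> norm w" "norm w \<le> 1" "r < norm b" "norm b < 1" "w \<noteq> b"
  shows "\<theta> (w / b) \<noteq> 0"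
proof -
  have "b \<noteq> 0" using assms r by auto
  then show ?thesis
    unfolding jtheta_split[OF r_bounds(1,2)]
    using jtheta_cofactor_nonzero[OF r_bounds(1,2) ratio_bounds[of w b]] assms by simp
qed

definition closed_annulus :: "complex set" where
  "closed_annulus = {w. r \<le> norm w \<and> norm w \<le> 1}"

lemma annulus_subset: "unit_annulus r \<subseteq> closed_annulus"
  by (auto simp: unit_annulus_def closed_annulus_def)

lemma closed_annulus_nonzero: "w \<in> closed_annulus \<Longrightarrow> w \<noteq> 0"
  using r by (auto simp: closed_annulus_def)

definition T :: "complex \<Rightarrow> complex \<Rightarrow> complex" where
  "T b w = \<theta> (w / b) / \<theta> (w * cnj b)"

lemma T_holomorphic:
  assumes "r < norm b" "norm b < 1"
  shows "T b holomorphic_on closed_annulus"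
proof -
  have "b \<noteq> 0" using assms r by auto
  then show ?thesis
    unfolding T_def [abs_def] using assms closed_annulus_nonzero
    by (intro holomorphic_on_divide jtheta_holomorphic r_bounds theta_outside_nonzero holomorphic_intros)
      (auto simp: closed_annulus_def)
qed

lemma T_outer:
  assumes "norm w = 1" "r < norm b" "norm b < 1"
  shows "norm (T b w) = 1 / norm b"
proof -
  have "b \<noteq> 0" using assms r by auto
  then show ?thesis
    using cnj_theta_outer[of w b] theta_outside_nonzero[of w b] assms r
    by (simp add: T_def norm_divide norm_mult)
qed

lemma T_inner:
  assumes "norm w = r" "r < norm b" "norm b < 1"
  shows "norm (T b w) = 1"
  using cnj_theta_inner[of w b] theta_outside_nonzero[of w b] assms r
  by (simp add: T_def norm_divide norm_mult)

lemma T_self [simp]: "b \<noteq> 0 \<Longrightarrow> T b b = 0"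
  by (simp add: T_def jtheta_split[OF r_bounds(1,2)])

lemma T_nonzero:
  assumes "w \<in> closed_annulus" "r < norm b" "norm b < 1" "w \<noteq> b"
  shows "T b w \<noteq> 0"
  using assms theta_inside_nonzero[of w b] theta_outside_nonzero[of w b]
  by (simp add: T_def closed_annulus_def)

text \<open>Reflection in the line through the origin that bisects \<open>b\<close> and \<open>c\<close> exchanges \<open>T b\<close> and
  \<open>T c\<close> up to conjugation.\<close>

lemma norm_T_bisector:
  assumes "norm b = norm c" "b \<noteq> c" "b \<noteq> 0" "Re (w * cnj (b - c)) = 0"
  shows "norm (T b w) = norm (T c w)"
proof -
  have "complex_of_real (2 * Re (w * cnj (b - c))) = w * cnj (b - c) + cnj (w * cnj (b - c))"
    by (simp only: complex_add_cnj)
  then have 1: "w * cnj (b - c) + cnj w * (b - c) = 0"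
    unfolding assms(4) by (simp only: complex_cnj_mult complex_cnj_cnj mult_zero_right of_real_0)
  have 2: "b * cnj b = c * cnj c"
    using assms(1) by (simp only: complex_norm_square[symmetric])
  \<comment> \<open>Both summands on the right vanish, and \<open>b - c\<close> can be cancelled;
    this expresses that the reflection fixing \<open>w\<close> exchanges \<open>b\<close> and
    \<open>c\<close>.\<close>
  have "(b - c) * (cnj w * c - w * cnj b) = c * (w * cnj (b - c) + cnj w * (b - c)) + w * (c * cnj c - b * cnj b)"
    by (simp add: algebra_simps)
  then have 3: "cnj w * c = w * cnj b" using 1 2 assms by simp
  then have "w * cnj c = cnj w * b" by (metis complex_cnj_cnj complex_cnj_mult)
  have c0: "c \<noteq> 0" using assms by auto
  have "cnj (w / b) = w / c" using 3 assms c0 by (simp add: field_simps)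
  moreover have "cnj (w * cnj b) = w * cnj c" using \<open>w * cnj c = cnj w * b\<close> by simp
  ultimately have "cnj (T b w) = T c w" by (simp only: T_def complex_cnj_divide cnj_jtheta r_bounds)
  then show ?thesis by (metis complex_mod_cnj)
qed

text \<open>Maximum principle for \<open>T b / T c\<close> on the half annulus on the side of
  \<open>b\<close> of the bisector: the quotient is holomorphic there, as \<open>c\<close> lies on
  the other side, and unimodular on the bisector and on both boundary arcs.\<close>

lemma norm_T_le:
  assumes b: "r < norm b" "norm b < 1" "norm c = norm b"
    and z: "z \<in> unit_annulus r" "Re (z * cnj (b - c)) \<ge> 0"
  shows "norm (T b z) \<le> norm (T c z)"
proof (cases "b = c \<or> Re (z * cnj (b - c)) = 0")
  case True
  then show ?thesis using norm_T_bisector[of b c z] b r by fastforce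
next
  case False
  define S where "S = {w \<in> unit_annulus r. Re (w * cnj (b - c)) > 0}"
  define D where "D = {w \<in> closed_annulus. Re (w * cnj (b - c)) \<ge> 0}"
  \<comment> \<open>For |b| = |c|, \<open>Re (c * cnj (b - c))\<close> equals -|b - c|^2 / 2, which
    is negative.\<close>
  have nc: "w \<noteq> c" if "w \<in> D" for w
  proof
    assume "w = c"
    then have "Re (c * cnj (b - c)) \<ge> 0" using that by (simp add: D_def)
    moreover have "(norm (b - c))\<^sup>2 = (norm b)\<^sup>2 + (norm c)\<^sup>2 - 2 * Re (c * cnj b)"
      unfolding cmod_power2 by (simp add: power2_eq_square algebra_simps)
    moreover have "Re (c * cnj (b - c)) = Re (c * cnj b) - (norm c)\<^sup>2"
      unfolding cmod_power2 by (simp add: power2_eq_square algebra_simps)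
    ultimately have "(norm (b - c))\<^sup>2 \<le> 0" using b by simp
    then show False using False by simp
  qed
  have holo: "(\<lambda>w. T b w / T c w) holomorphic_on D"
    using b nc by (intro holomorphic_on_divide holomorphic_on_subset[OF T_holomorphic] T_nonzero)
      (auto simp: D_def)
  have "closed D"
  proof -
    have "D = (cball 0 1 - ball 0 r) \<inter> {w. Re (w * cnj (b - c)) \<ge> 0}"
      by (auto simp: D_def closed_annulus_def)
    moreover have "closed {w. Re (w * cnj (b - c)) \<ge> 0}"
      by (intro closed_Collect_le continuous_intros)
    ultimately show ?thesis by (simp add: closed_Diff closed_Int)
  qed
  have "open S"
  proof -
    have "S = unit_annulus r \<inter> {w. Re (w * cnj (b - c)) > 0}" by (auto simp: S_def)
    moreover have "open {w. Re (w * cnj (b - c)) > 0}"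
      by (intro open_Collect_less continuous_intros)
    ultimately show ?thesis by (simp add: open_Int open_unit_annulus)
  qed
  have "S \<subseteq> D" using annulus_subset by (auto simp: S_def D_def)
  then have cl: "closure S \<subseteq> D" using \<open>closed D\<close> by (rule closure_minimal)
  have "norm (T b z / T c z) \<le> 1"
  proof (rule maximum_modulus_frontier[of "\<lambda>w. T b w / T c w" S])
    show "(\<lambda>w. T b w / T c w) holomorphic_on interior S"
      using holo interior_subset \<open>S \<subseteq> D\<close> holomorphic_on_subset by blast
    show "continuous_on (closure S) (\<lambda>w. T b w / T c w)"
      using holo cl holomorphic_on_imp_continuous_on continuous_on_subset by blast
    show "bounded S"
      by (rule bounded_subset[of "ball 0 1"]) (auto simp: S_def unit_annulus_def)
    show "z \<in> S" using z False by (auto simp: S_def)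
    fix w assume "w \<in> frontier S"
    then have w: "w \<in> D" "w \<notin> S" using cl \<open>open S\<close> by (auto simp: frontier_def interior_open)
    have "T c w \<noteq> 0" using nc[OF w(1)] w b by (intro T_nonzero) (auto simp: D_def)
    moreover have "norm (T b w) = norm (T c w)"
    proof -
      consider "norm w = r" | "norm w = 1" | "Re (w * cnj (b - c)) = 0"
        using w by (fastforce simp: S_def D_def unit_annulus_def closed_annulus_def)
      then show ?thesis
      proof cases
        case 3
        then show ?thesis using norm_T_bisector[of b c w] False b r by fastforce
      qed (use T_inner T_outer b in auto)
    qed
    ultimately show "norm (T b w / T c w) \<le> 1" by (simp add: norm_divide)
  qed
  moreover have "T c z \<noteq> 0"
    using nc[of z] z False annulus_subset b by (intro T_nonzero) (auto simp: D_def)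
  ultimately show ?thesis by (simp add: norm_divide)
qed

section \<open>The extremal problem with a prescribed zero\<close>

text \<open>An instance of \<open>dual_extremal\<close>. That \<open>c\<close> lies on the ray
  opposite to \<open>z\<close> is what gives the dual function its opposite signs on the two
  boundary circles.\<close>

lemma extremal_bound:
  fixes z b c :: complex
  assumes z: "z \<in> unit_annulus r" and b: "norm b = sqrt r" and c: "norm c = sqrt r" "z = - of_real t * c" "0 < t"
    and g: "g holomorphic_on unit_annulus r" "g ` unit_annulus r \<subseteq> unit_disk" "g b = 0" and "b \<noteq> z"
  shows "norm (g z) \<le> norm (of_real r / z * T b z * T c z)"
proof -
  define E where "E = (\<lambda>x. qpoch (r\<^sup>2) (of_real (r\<^sup>2) * x) * qpoch (r\<^sup>2) (of_real (r\<^sup>2) / x))"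
  have theta_E: "\<theta> x = (1 - x) * E x" for x
    unfolding E_def by (rule jtheta_split) (rule r_bounds)+
  define F where "F = (\<lambda>w. of_real r / w * T b w * T c w)"
  \<comment> \<open>Obtained by solving for the desired dual function: the zeros of theta at
    \<open>b\<close> and \<open>z\<close> are carried by \<open>w - b\<close> and
    \<open>w - z\<close>, and only their nonvanishing cofactors \<open>E\<close> remain in the
    denominator.\<close>
  define R where "R = (\<lambda>w. w / of_real r * \<theta> (w * cnj b) * (\<theta> (w * cnj c))\<^sup>2 * (b * z) /
    (E (w / b) * E (w / z) * \<theta> (w * cnj z)))"
  have bb: "r < norm b" "norm b < 1" and cc: "r < norm c" "norm c < 1" and zz: "r < norm z" "norm z < 1"
    using b c z r_bounds by (auto simp: unit_annulus_def)
  then have nz: "b \<noteq> 0" "c \<noteq> 0" "z \<noteq> 0" using r by auto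
  have E_nz: "E (w / d) \<noteq> 0" if "w \<in> closed_annulus" "r < norm d" "norm d < 1" for w d
    unfolding E_def using that jtheta_cofactor_nonzero[OF r_bounds(1,2) ratio_bounds[of w d]]
    by (simp add: closed_annulus_def)
  have out_nz: "\<theta> (w * cnj d) \<noteq> 0" if "w \<in> closed_annulus" "r < norm d" "norm d < 1" for w d
    using that by (intro theta_outside_nonzero) (auto simp: closed_annulus_def)
  have F_holo: "F holomorphic_on closed_annulus"
    unfolding F_def using closed_annulus_nonzero bb cc
    by (intro holomorphic_on_mult holomorphic_on_divide T_holomorphic holomorphic_intros) auto
  have E_holo: "(\<lambda>w. E (w / d)) holomorphic_on closed_annulus" if "d \<noteq> 0" for d
    unfolding E_def
    by (rule jtheta_cofactor_holomorphic[OF r_bounds(1,2)])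
      (use that closed_annulus_nonzero in \<open>auto intro!: holomorphic_intros\<close>)
  have R_holo: "R holomorphic_on closed_annulus"
    unfolding R_def
  proof (intro holomorphic_on_mult holomorphic_on_divide holomorphic_on_power jtheta_holomorphic r_bounds)
    show "(\<lambda>w. E (w / b)) holomorphic_on closed_annulus" "(\<lambda>w. E (w / z)) holomorphic_on closed_annulus"
      using E_holo nz by blast+
    fix w assume "w \<in> closed_annulus"
    then show "E (w / b) * E (w / z) * \<theta> (w * cnj z) \<noteq> 0"
      using E_nz out_nz bb zz by simp
  qed (use r nz closed_annulus_nonzero in \<open>auto intro!: holomorphic_intros\<close>)
  have P: "F w * R w / ((w - z) * (w - b)) =
      \<theta> (w / c) * \<theta> (w * cnj c) / (\<theta> (w / z) * \<theta> (w * cnj z))"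
    if w: "w \<in> closed_annulus" "w \<noteq> b" "w \<noteq> z" for w
  proof -
    have 1: "b * \<theta> (w / b) = - (w - b) * E (w / b)" "z * \<theta> (w / z) = - (w - z) * E (w / z)"
      using nz by (simp_all add: theta_E field_simps)
    \<comment> \<open>The cancellation is done for arbitrary field elements in place of the theta
      values.\<close>
    have alg: "(rr / x * (A / A') * (B / B')) * (x / rr * A' * B'\<^sup>2 * (b * z) / (e1 * e2 * C')) / ((x - z) * (x - b)) =
       B * B' / (C * C')"
      if "rr \<noteq> 0" "x \<noteq> 0" "A' \<noteq> 0" "B' \<noteq> 0" "C' \<noteq> 0" "e1 \<noteq> 0" "e2 \<noteq> 0" "x \<noteq> z" "x \<noteq> b"
       "b * A = - (x - b) * e1" "z * C = - (x - z) * e2" for rr x A A' B B' e1 e2 C C' :: complex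
    proof -
      have "A = (x - b) * (- e1 / b)" "C = (x - z) * (- e2 / z)" using that nz by (auto simp: field_simps)
      then show ?thesis using that nz by (simp add: power2_eq_square mult_ac)
    qed
    show ?thesis
      unfolding F_def R_def T_def
      using closed_annulus_nonzero[OF w(1)] r w 1 bb cc zz
      by (intro alg out_nz E_nz) auto
  qed
  have normF: "norm (F z) = norm (of_real r / z * T b z * T c z)" by (simp add: F_def)
  have "norm (g z) \<le> norm (F z)"
  proof (rule dual_extremal[where r = r and b = b and g = g and F = F and R = R])
    have A: "{w. r < norm w \<and> norm w < 1} = unit_annulus r"
      and C: "{w. r \<le> norm w \<and> norm w \<le> 1} = closed_annulus"
      by (simp_all add: unit_annulus_def closed_annulus_def)
    show "F holomorphic_on {w. r < norm w \<and> norm w < 1}" "R holomorphic_on {w. r < norm w \<and> norm w < 1}"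
      unfolding A using F_holo R_holo annulus_subset holomorphic_on_subset by blast+
    show "continuous_on {w. r \<le> norm w \<and> norm w \<le> 1} F" "continuous_on {w. r \<le> norm w \<and> norm w \<le> 1} R"
      unfolding C by (intro holomorphic_on_imp_continuous_on F_holo R_holo)+
    show "g holomorphic_on {w. r < norm w \<and> norm w < 1}" unfolding A by (rule g)
    show "norm (g w) \<le> 1" if "w \<in> {w. r < norm w \<and> norm w < 1}" for w
      using that g(2) unfolding A by (auto simp: image_subset_iff less_imp_le)
    show "F b = 0" using nz by (simp add: F_def)
    have "z \<noteq> c"
    proof
      assume "z = c"
      then have "- of_real t * c = 1 * c" using c(2) by simp
      then have "- of_real t = (1 :: complex)" using nz by (simp only: mult_cancel_right) auto
      then have "Re (- of_real t) = Re 1" by (rule arg_cong)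
      then show False using \<open>0 < t\<close> by simp
    qed
    then show "F z \<noteq> 0"
      using T_nonzero[of z b] T_nonzero[of z c] bb cc zz nz \<open>b \<noteq> z\<close> r
      by (simp add: F_def closed_annulus_def)
    fix w :: complex
    show "norm (F w) = 1 \<and> (\<exists>p>0. F w * R w / ((w - z) * (w - b)) = - of_real p)" if w: "norm w = 1"
    proof
      show "norm (F w) = 1"
        using w r b c T_outer[OF w bb] T_outer[OF w cc] by (simp add: F_def norm_mult norm_divide)
      have "w \<in> closed_annulus" using w r by (simp add: closed_annulus_def)
      moreover from this have "\<theta> (w * cnj c) \<noteq> 0" "\<theta> (w * cnj z) \<noteq> 0" using out_nz cc zz by auto
      moreover have "w \<noteq> 0" "w \<noteq> b" "w \<noteq> z" using w bb zz by auto
      \<comment> \<open>The factor \<open>z / c\<close>, equal to -t, is the quotient of the factors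
        \<open>- (w / c)\<close> and \<open>- (w / z)\<close> from \<open>cnj_theta_outer\<close>.
        It makes the value negative.\<close>
      ultimately have "F w * R w / ((w - z) * (w - b)) =
          (z / c) * ((cnj (\<theta> (w * cnj c)) * \<theta> (w * cnj c)) / (cnj (\<theta> (w * cnj z)) * \<theta> (w * cnj z)))"
        using nz by (simp add: P cnj_theta_outer[OF w])
      also have "\<dots> = - of_real (t * ((norm (\<theta> (w * cnj c)))\<^sup>2 / (norm (\<theta> (w * cnj z)))\<^sup>2))"
        using nz c(2) by (simp add: complex_norm_square mult.commute del: of_real_power)
      finally have *: "F w * R w / ((w - z) * (w - b)) =
          - of_real (t * ((norm (\<theta> (w * cnj c)))\<^sup>2 / (norm (\<theta> (w * cnj z)))\<^sup>2))" .
      have pos: "0 < t * ((norm (\<theta> (w * cnj c)))\<^sup>2 / (norm (\<theta> (w * cnj z)))\<^sup>2)"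
        using \<open>\<theta> (w * cnj c) \<noteq> 0\<close> \<open>\<theta> (w * cnj z) \<noteq> 0\<close> \<open>0 < t\<close> by simp
      show "\<exists>p>0. F w * R w / ((w - z) * (w - b)) = - of_real p"
        using pos * by blast
    qed
    show "norm (F w) = 1 \<and> (\<exists>p>0. F w * R w / ((w - z) * (w - b)) = of_real p)" if w: "norm w = r"
    proof
      show "norm (F w) = 1"
        using w r b c T_inner[OF w bb] T_inner[OF w cc] by (simp add: F_def norm_mult norm_divide)
      have "w \<in> closed_annulus" using w r by (simp add: closed_annulus_def)
      moreover from this have "\<theta> (w * cnj c) \<noteq> 0" "\<theta> (w * cnj z) \<noteq> 0" using out_nz cc zz by auto
      moreover have "w \<noteq> b" "w \<noteq> z" using w bb zz by auto
      ultimately have "F w * R w / ((w - z) * (w - b)) =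
          ((cnj (\<theta> (w * cnj c)) * \<theta> (w * cnj c)) / (cnj (\<theta> (w * cnj z)) * \<theta> (w * cnj z)))"
        by (simp add: P cnj_theta_inner[OF w])
      also have "\<dots> = of_real ((norm (\<theta> (w * cnj c)))\<^sup>2 / (norm (\<theta> (w * cnj z)))\<^sup>2)"
        by (simp add: complex_norm_square mult.commute del: of_real_power)
      finally have *: "F w * R w / ((w - z) * (w - b)) =
          of_real ((norm (\<theta> (w * cnj c)))\<^sup>2 / (norm (\<theta> (w * cnj z)))\<^sup>2)" .
      have pos: "0 < (norm (\<theta> (w * cnj c)))\<^sup>2 / (norm (\<theta> (w * cnj z)))\<^sup>2"
        using \<open>\<theta> (w * cnj c) \<noteq> 0\<close> \<open>\<theta> (w * cnj z) \<noteq> 0\<close> by simp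
      show "\<exists>p>0. F w * R w / ((w - z) * (w - b)) = of_real p"
        using pos * by blast
    qed
  qed (use r z b bb zz \<open>b \<noteq> z\<close> g in auto)
  then show ?thesis by (simp only: normF)
qed


section \<open>The Fridman function in terms of theta\<close>

lemma T_ray_real:
  assumes "norm u = 1" "0 < \<rho>"
  shows "T (- of_real \<rho> * u) (of_real t * u) =
    of_real (Re (T (- of_real \<rho> * u) (of_real t * u)))"
    and "T (- of_real \<rho> * u) (of_real t * u) = \<theta> (- of_real (t / \<rho>)) / \<theta> (- of_real (t * \<rho>))"
proof -
  have "u \<noteq> 0" using assms by auto
  have "u * cnj u = 1" using assms complex_norm_square[of u] by simp
  then have den: "of_real t * u * cnj (- of_real \<rho> * u) = - of_real (t * \<rho>)"
    by (simp add: mult_ac)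
  have num: "of_real t * u / (- of_real \<rho> * u) = - of_real (t / \<rho>)"
    using \<open>u \<noteq> 0\<close> by simp
  then show *: "T (- of_real \<rho> * u) (of_real t * u) = \<theta> (- of_real (t / \<rho>)) / \<theta> (- of_real (t * \<rho>))"
    by (simp only: T_def den num)
  have "T (- of_real \<rho> * u) (of_real t * u) \<in> \<real>"
    unfolding * by (simp add: Reals_cnj_iff cnj_jtheta[OF r_bounds(1,2)])
  then show "T (- of_real \<rho> * u) (of_real t * u) =
    of_real (Re (T (- of_real \<rho> * u) (of_real t * u)))" by simp
qed

text \<open>Stated in the complex numbers because theta is complex-valued; both theta arguments are
  real here.\<close>

lemma fridman_caratheodory_eq:
  assumes z: "z \<in> unit_annulus r"
  defines "a \<equiv> norm z"
  shows "complex_of_real (fridman_caratheodory (unit_annulus r) z) =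
    of_real (r / a) * (\<theta> (- of_real (a / sqrt r)) / \<theta> (- of_real (a * sqrt r)))\<^sup>2"
proof -
  have a: "r < a" "a < 1" "0 < a" using z r by (auto simp: a_def unit_annulus_def)
  then have "z \<noteq> 0" by (auto simp: a_def)
  define u where "u = z / of_real a"
  have u: "norm u = 1" using a by (simp add: u_def norm_divide a_def[symmetric])
  have z_eq: "z = of_real a * u" using a by (simp add: u_def)
  \<comment> \<open>The radius \<open>sqrt r\<close> makes \<open>K\<close> unimodular on both
    circles: on the outer one |T c|^2 is 1/r, against the factor \<open>r\<close>.\<close>
  define c where "c = - of_real (sqrt r) * u"
  have c: "norm c = sqrt r" using u r by (simp add: c_def norm_mult)
  then have cc: "r < norm c" "norm c < 1" "c \<noteq> 0" using r_bounds r by auto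
  define \<tau> where "\<tau> = (\<lambda>t. Re (T c (of_real t * u)))"
  have T_ray: "T c (of_real t * u) = of_real (\<tau> t)" for t
    unfolding \<tau>_def c_def using u r by (intro T_ray_real) auto
  define M where "M = r / a * (\<tau> a)\<^sup>2"
  \<comment> \<open>The rotation by \<open>u\<close> makes \<open>K\<close> real on the line through
    \<open>z\<close> and 0, where it is \<open>r / t\<close> times a square and so takes its sign
    from t.\<close>
  define K where "K = (\<lambda>w. of_real r * u / w * (T c w)\<^sup>2)"
  have K_ray: "K (of_real t * u) = of_real (r / t * (\<tau> t)\<^sup>2)" for t
    unfolding K_def T_ray using u by (auto simp: power2_eq_square)
  have K_holo: "K holomorphic_on closed_annulus"
    unfolding K_def using closed_annulus_nonzero cc
    by (intro holomorphic_on_mult holomorphic_on_divide holomorphic_on_power T_holomorphic holomorphic_intros) auto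
  have closed: "closed closed_annulus"
  proof -
    have "closed_annulus = cball 0 1 - ball 0 r" by (auto simp: closed_annulus_def)
    then show ?thesis by (simp add: closed_Diff)
  qed
  have cl: "closure (unit_annulus r) \<subseteq> closed_annulus"
    using annulus_subset closed by (rule closure_minimal)
  have K_le: "norm (K w) \<le> 1" if "w \<in> unit_annulus r" for w
  proof (rule maximum_modulus_frontier[of K "unit_annulus r"])
    show "K holomorphic_on interior (unit_annulus r)"
      using K_holo annulus_subset interior_subset holomorphic_on_subset by blast
    show "continuous_on (closure (unit_annulus r)) K"
      using K_holo cl holomorphic_on_imp_continuous_on continuous_on_subset by blast
    show "bounded (unit_annulus r)"
      by (rule bounded_subset[of "ball 0 1"]) (auto simp: unit_annulus_def)
    show "norm (K v) \<le> 1" if "v \<in> frontier (unit_annulus r)" for v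
    proof -
      have "v \<in> closed_annulus" "v \<notin> unit_annulus r"
        using that cl open_unit_annulus by (auto simp: frontier_def interior_open)
      then have "norm v = r \<or> norm v = 1" by (auto simp: closed_annulus_def unit_annulus_def)
      then show ?thesis
        using T_inner[of v c] T_outer[of v c] cc c u r
        by (auto simp: K_def norm_mult norm_divide norm_power power_divide)
    qed
  qed (rule that)
  \<comment> \<open>Equality would make \<open>K\<close> constant, although it vanishes at
    \<open>c\<close> and has modulus 1 at \<open>w\<close>.\<close>
  have K_less: "norm (K w) < 1" if w: "w \<in> unit_annulus r" for w
  proof (rule ccontr)
    assume "\<not> norm (K w) < 1"
    then have nw: "norm (K w) = 1" using K_le[OF w] by simp
    have "K constant_on unit_annulus r"
    proof (rule maximum_modulus_principle[of K "unit_annulus r" "unit_annulus r" w])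
      show "K holomorphic_on unit_annulus r"
        using K_holo annulus_subset holomorphic_on_subset by blast
      show "connected (unit_annulus r)"
        using connected_annulus(1)[of r "0 :: complex" 1] by (simp add: unit_annulus_def)
    qed (use w nw K_le open_unit_annulus in auto)
    moreover have "c \<in> unit_annulus r" using cc by (simp add: unit_annulus_def)
    ultimately have "K w = K c" using w by (metis constant_on_def)
    moreover have "K c = 0" using cc by (simp add: K_def)
    ultimately show False using nw by simp
  qed
  have "z \<noteq> c"
  proof
    assume "z = c"
    then have "of_real (a + sqrt r) * u = 0" by (simp add: z_eq c_def algebra_simps)
    moreover have "a + sqrt r > 0" using a r by (simp add: add_pos_pos)
    ultimately show False using u by (auto simp del: of_real_add)
  qed
  have Kz: "K z = of_real M" unfolding z_eq K_ray M_def ..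
  have "K z \<noteq> 0"
    using T_nonzero[of z c] z annulus_subset cc \<open>z \<noteq> c\<close> \<open>z \<noteq> 0\<close> u r by (auto simp: K_def)
  moreover have "M \<ge> 0" using a r by (simp add: M_def)
  ultimately have M: "0 < M" "M < 1"
    using Kz K_less[OF z] by auto
  have normK: "norm (of_real r / z * T c z * T c z) = M"
  proof -
    have "norm (of_real r / z * T c z * T c z) = norm (K z)"
      using u by (simp add: K_def norm_mult norm_divide power2_eq_square)
    then show ?thesis using Kz M by simp
  qed
  have "fridman_caratheodory (unit_annulus r) z = M"
  proof (rule fridman_caratheodory_annulus_eqI[of r M u "sqrt r"])
    fix t :: real assume t: "r < t" "t < 1"
    show "ereal (2 * artanh M) \<le> caratheodory_dist (unit_annulus r) z (- of_real t * u)"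
    proof (rule caratheodory_dist_ge[of K])
      show "K holomorphic_on unit_annulus r"
        using K_holo annulus_subset holomorphic_on_subset by blast
      show "K ` unit_annulus r \<subseteq> unit_disk" using K_less by auto
      show "- of_real t * u \<in> unit_annulus r" using t r u by (simp add: unit_annulus_def norm_mult)
      have "r / (- t) * (\<tau> (- t))\<^sup>2 \<le> 0" using t r by (simp add: divide_nonneg_pos)
      then show "Re (K (- of_real t * u)) \<le> 0" using K_ray[of "- t"] by simp
    qed (use z Kz M in auto)
  next
    fix w :: complex assume w: "norm w = sqrt r"
    show "caratheodory_dist (unit_annulus r) z w \<le> ereal (2 * artanh M)"
    proof (rule caratheodory_dist_le)
      fix g assume g: "g holomorphic_on unit_annulus r" "g ` unit_annulus r \<subseteq> unit_disk" "g w = 0"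
      show "norm (g z) \<le> M"
      \<comment> \<open>The point \<open>z\<close> may itself lie on the circle of radius
        \<open>sqrt r\<close>; then \<open>g z\<close> is 0.\<close>
      proof (cases "w = z")
        case False
        have zc: "z = - of_real (a / sqrt r) * c" using r by (simp add: c_def z_eq)
        have "norm (g z) \<le> norm (of_real r / z * T w z * T c z)"
          using a r by (intro extremal_bound[OF z w c zc _ g False]) simp
        also have "\<dots> \<le> norm (of_real r / z * T c z * T c z)"
        proof -
          \<comment> \<open>As \<open>z\<close> is a negative multiple of \<open>c\<close>, this
            puts \<open>z\<close> on the side of \<open>w\<close> of the bisector of
            \<open>w\<close> and \<open>c\<close>, as \<open>norm_T_le\<close> demands.\<close>
          have "Re (c * cnj w) \<le> r"
            using complex_Re_le_cmod[of "c * cnj w"] w c r by (simp add: norm_mult)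
          moreover have "Re (c * cnj c) = r"
            using c r by (simp add: complex_norm_square[symmetric] del: of_real_power)
          ultimately have "0 \<le> - (a / sqrt r) * (Re (c * cnj w) - Re (c * cnj c))"
            using a r by (intro mult_nonpos_nonpos) simp_all
          also have "\<dots> = Re (z * cnj (w - c))"
          proof -
            have "Re (- of_real k * c * cnj (w - c)) = - k * (Re (c * cnj w) - Re (c * cnj c))" for k
              by (simp add: algebra_simps)
            then show ?thesis unfolding zc by (rule sym)
          qed
          finally have "0 \<le> Re (z * cnj (w - c))" .
          then have "norm (T w z) \<le> norm (T c z)"
            using z w c cc by (intro norm_T_le) auto
          then show ?thesis unfolding norm_mult by (intro mult_right_mono mult_left_mono) auto
        qed
        finally show ?thesis by (simp only: normK)
      qed (use g M in auto)
    qed (use M z w r_bounds r in \<open>auto simp: unit_annulus_def\<close>)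
  qed (use r(1) M u r_bounds(3,4) r(2) z in auto)
  also have "complex_of_real M = of_real (r / a) * (T c z)\<^sup>2"
    by (simp add: M_def z_eq T_ray)
  also have "T c z = \<theta> (- of_real (a / sqrt r)) / \<theta> (- of_real (a * sqrt r))"
    unfolding c_def z_eq using u r by (intro T_ray_real) auto
  finally show ?thesis .
qed

end

section \<open>The product formula\<close>

lemma jtheta_neg_of_real:
  assumes "0 < q" "q < 1"
  shows "jtheta q (- of_real x) = of_real ((\<Prod>n. 1 + q ^ n * x) * (\<Prod>n. 1 + q ^ n * (q / x)))"
proof -
  have "qpoch q (- of_real y) = of_real (\<Prod>n. 1 + q ^ n * y)" for y
    using qpoch_of_real[OF assms, of "- y"] by simp
  from this[of x] this[of "q / x"] show ?thesis by (simp add: jtheta_def)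
qed

lemma qpoch_neg_convergent:
  assumes "0 < q" "q < 1"
  shows "convergent_prod (\<lambda>n. 1 + q ^ n * (x :: real))"
  using qpoch_convergent[OF assms, of "- x"] by simp

theorem theorem3p6:
  fixes r :: real and z :: complex
  assumes "0 < r" and "r < 1" and "z \<in> unit_annulus r"
  shows "fridman_caratheodory (unit_annulus r) z =
    sqrt r * (1 + sqrt r / norm z) * (1 + norm z / sqrt r) *
    (prodinf (\<lambda>k. let n = real (Suc k) in
        ((1 + norm z * r powr (2 * n - 1/2)) * (norm z + r powr (2 * n + 1/2))) /
        ((1 + norm z * r powr (2 * n - 3/2)) * (norm z + r powr (2 * n - 1/2)))))\<^sup>2"
proof -
  interpret annulus r by unfold_locales fact+
  define a s where "a = norm z" and "s = sqrt r"
  have a: "0 < a" using assms by (auto simp: a_def unit_annulus_def)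
  have s: "0 < s" "s * s = r" using r by (auto simp: s_def)
  define p where "p = (\<lambda>x::real. \<Prod>n. 1 + (r\<^sup>2) ^ n * x)"
  have conv: "convergent_prod (\<lambda>n. 1 + (r\<^sup>2) ^ n * x)" for x :: real
    by (intro qpoch_neg_convergent r_bounds)
  have theta_p: "\<theta> (- of_real x) = of_real (p x * p (r\<^sup>2 / x))" for x
    unfolding p_def by (intro jtheta_neg_of_real r_bounds)
  \<comment> \<open>Splitting off the factor with index 0 produces the prefactor and shifts the rest
    to the product that starts at n = 1.\<close>
  have p_rec: "p (a / s) = (1 + a / s) * p (r\<^sup>2 * (a / s))"
    using prodinf_split_head[OF conv[of "a / s"]] a s
    by (simp add: p_def mult_ac add_pos_pos less_imp_neq[symmetric])
  \<comment> \<open>Here n is \<open>Suc k\<close>, so each exponent is 2k plus a remainder: 3/2,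
    5/2 and 1/2.\<close>
  have powr: "r powr (2 * real (Suc k) - 1/2) = (r\<^sup>2) ^ k * (r * s)"
    "r powr (2 * real (Suc k) + 1/2) = (r\<^sup>2) ^ k * (r\<^sup>2 * s)"
    "r powr (2 * real (Suc k) - 3/2) = (r\<^sup>2) ^ k * s" for k
  proof -
    have e: "r powr (2 * real k) = (r\<^sup>2) ^ k"
      using powr_realpow[OF r(1), of "2 * k"] by (simp add: power_mult)
    have h: "r powr (1/2) = s" using r by (simp add: s_def powr_half_sqrt)
    have "2 * real (Suc k) - 1/2 = 2 * real k + 1 + 1/2" "2 * real (Suc k) + 1/2 = 2 * real k + 2 + 1/2"
      "2 * real (Suc k) - 3/2 = 2 * real k + 1/2" by simp_all
    then show "r powr (2 * real (Suc k) - 1/2) = (r\<^sup>2) ^ k * (r * s)"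
      "r powr (2 * real (Suc k) + 1/2) = (r\<^sup>2) ^ k * (r\<^sup>2 * s)"
      "r powr (2 * real (Suc k) - 3/2) = (r\<^sup>2) ^ k * s"
      using r by (simp_all only: powr_add e h) simp_all
  qed
  have "(\<Prod>k. let n = real (Suc k) in
        ((1 + a * r powr (2 * n - 1/2)) * (a + r powr (2 * n + 1/2))) /
        ((1 + a * r powr (2 * n - 3/2)) * (a + r powr (2 * n - 1/2)))) =
      (\<Prod>k. ((1 + (r\<^sup>2) ^ k * (r\<^sup>2 * (a / s))) * (1 + (r\<^sup>2) ^ k * (r\<^sup>2 / (a / s)))) /
        ((1 + (r\<^sup>2) ^ k * (a * s)) * (1 + (r\<^sup>2) ^ k * (r\<^sup>2 / (a * s)))))"
  proof (rule prodinf_cong)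
    fix k
    have e: "r\<^sup>2 * (a / s) = a * (r * s)" "r\<^sup>2 / (a / s) = r\<^sup>2 * s / a" "r\<^sup>2 / (a * s) = r * s / a"
      using s(1) a by (simp_all add: s(2)[symmetric] power2_eq_square field_simps)
    \<comment> \<open>Normalises the factors to the form 1 + x; the powers of \<open>a\<close> must
      cancel in each term for the separate products to converge.\<close>
    have "(A * (a + B)) / (C * (a + D)) = (A * (1 + B / a)) / (C * (1 + D / a))" for A B C D
    proof -
      have "a + x = a * (1 + x / a)" for x using a by (simp add: field_simps)
      then have "(A * (a + B)) / (C * (a + D)) = (a * (A * (1 + B / a))) / (a * (C * (1 + D / a)))"
        by (metis mult.left_commute)
      then show ?thesis using a by simp
    qed
    then show "(let n = real (Suc k) in
        ((1 + a * r powr (2 * n - 1/2)) * (a + r powr (2 * n + 1/2))) /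
        ((1 + a * r powr (2 * n - 3/2)) * (a + r powr (2 * n - 1/2)))) =
      ((1 + (r\<^sup>2) ^ k * (r\<^sup>2 * (a / s))) * (1 + (r\<^sup>2) ^ k * (r\<^sup>2 / (a / s)))) /
        ((1 + (r\<^sup>2) ^ k * (a * s)) * (1 + (r\<^sup>2) ^ k * (r\<^sup>2 / (a * s))))"
      unfolding Let_def powr e by (simp add: mult_ac)
  qed
  also have "\<dots> = p (r\<^sup>2 * (a / s)) * p (r\<^sup>2 / (a / s)) / (p (a * s) * p (r\<^sup>2 / (a * s)))"
    unfolding p_def by (simp only: prodinf_divide prodinf_mult conv convergent_prod_mult)
  finally have prod_eq: "(\<Prod>k. let n = real (Suc k) in
        ((1 + a * r powr (2 * n - 1/2)) * (a + r powr (2 * n + 1/2))) /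
        ((1 + a * r powr (2 * n - 3/2)) * (a + r powr (2 * n - 1/2)))) =
      p (r\<^sup>2 * (a / s)) * p (r\<^sup>2 / (a / s)) / (p (a * s) * p (r\<^sup>2 / (a * s)))" .
  have "complex_of_real (fridman_caratheodory (unit_annulus r) z) =
      of_real (r / a * (p (a / s) * p (r\<^sup>2 / (a / s)) / (p (a * s) * p (r\<^sup>2 / (a * s))))\<^sup>2)"
    using fridman_caratheodory_eq[OF assms(3)] unfolding theta_p a_def[symmetric] s_def[symmetric]
    by simp
  then have "fridman_caratheodory (unit_annulus r) z =
      r / a * (p (a / s) * p (r\<^sup>2 / (a / s)) / (p (a * s) * p (r\<^sup>2 / (a * s))))\<^sup>2"
    by (simp only: of_real_eq_iff)
  also have "\<dots> = (r / a * (1 + a / s)\<^sup>2) *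
      (p (r\<^sup>2 * (a / s)) * p (r\<^sup>2 / (a / s)) / (p (a * s) * p (r\<^sup>2 / (a * s))))\<^sup>2"
    by (simp add: p_rec power_mult_distrib power_divide)
  \<comment> \<open>One of the two factors 1 + a/s absorbs r/a, because r = s^2.\<close>
  also have "r / a * (1 + a / s)\<^sup>2 = s * (1 + s / a) * (1 + a / s)"
    using a s(1) by (simp add: s(2)[symmetric] power2_eq_square field_simps)
  finally show ?thesis
    unfolding prod_eq[symmetric] by (simp only: a_def s_def)
qed

end
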